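(* Let $\mathbf I=\mathrm{diag}(I_1,I_2,I_2)$ with $0<I_i<\tfrac12$ and $I_1+2I_2=1$. Consider an isolated relative equilibrium $((\mathrm{Id},\mathbf R),(\xi,\eta))$ of the axisymmetric second order model, given by $$\xi=(0,\xi_2,0),\quad \mathbf R=(R,0,0),\quad |\xi|^2=\frac{2R^2+3-9I_1}{2R^5}>0,\quad \eta=0,\qquad R>0,$$ and suppose that the orbit is large in the sense that $$R^4>3R^2(2I_2-I_1)+15I_2(I_2-I_1).$$ Then: (i) if $I_1<I_2$ (prolate body), the equilibrium is $G^{\mathrm{axi}}_\mu$-stable; (ii) if $I_1>I_2$ and $4I_2-3I_1>\dfrac{6I_2(I_1-I_2)}{R^2}$, the equilibrium is unstable.
   Context: Axisymmetric second order satellite model. Units are chosen so that the satellite has mass $1$ and its inertia tensor $\mathbf I=\mathrm{diag}(I_1,I_2,I_2)$ has trace $1$; the first body axis $\mathbf e_1$ is the symmetry axis. The configuration space is $Q=SO(3)\times(\mathbb R^3\setminus\{0\})$ with points $(B,\mathbf R)$ in body coordinates. Tangent vectors are written $(\Omega,\dot{\mathbf R})\in\mathbb R^3\times\mathbb R^3$ with $\dot B=B\widehat\Omega$, where $\widehat\Omega u=\Omega\times u$. The kinetic energy is $K=\frac12(\Omega\cdot\mathbf I\Omega+|\dot{\mathbf R}+\Omega\times\mathbf R|^2)$, the potential is $$V_2(\mathbf R)=-\frac1R-\frac1{2R^3}+\frac{3}{2R^5}\,\mathbf R\cdot\mathbf I\mathbf R,\qquad R=|\mathbf R|,$$ and the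 system on $T^*Q$ has Hamiltonian $H_2=K+V_2$. Symmetry. Let $\Gamma^{\mathrm{axi}}\subset O(3)$ be the group of block matrices $\mathrm{diag}(s,O)$ with $s\in\{1,-1\}$, $O\in O(2)$, let $\chi(\mathrm{diag}(s,O))=\det O$, and let $G^{\mathrm{axi}}=SO(3)\times\Gamma^{\mathrm{axi}}$ act on $Q$ by $(M,N)\cdot(B,\mathbf R)=(MBN^T\det N,\,N\mathbf R)$, and on $T^*Q$ by cotangent lift. Its Lie algebra is identified with $\mathbb R^3\oplus\mathbb R$, where $(\xi,\eta)$ generates $(\exp(t\widehat\xi),\exp(t\eta\,\widehat{\mathbf e_1}))$, with infinitesimal generator $(\xi,\eta)_Q(B,\mathbf R)=(B^T\xi-\eta\mathbf e_1,\ \eta\,\mathbf e_1\times\mathbf R)$. The momentum map $\mathbf J:T^*Q\to\mathbb R^3\oplus\mathbb R$ is that of the cotangent lifted action, and the coadjoint action is $(M,N)\cdot(\mu,\nu)=(M\mu,\chi(N)\nu)$. A relative equilibrium with velocity $(\xi,\eta)$ is a phase space point whose evolution is the orbit of the one-parameter subgroup generated by $(\xi,\eta)$; the pair $(q,(\xi,\eta))$ denotes the point of $T^*_qQ$ that is the Legendre transform of $(\xi,\eta)_Q(q)$. $G^{\mathrm{axi}}_\mu$ is the stabilizer of its momentum value $\mu\in\mathbb R^3\oplus\mathbb R$. Stability. For a symmetry group $G$, a relative equilibrium $p$ with momentum $\mu$ is $G_\mu$-stable if for every $G_\mu$-invariant neighborhood $U$ of $G_\mu\cdot p$ there is a neighborhood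 $O$ of $p$ such that the Hamiltonian evolution of $O$ stays in $U$ for all time. It is called unstable when the linearization at $p$ of the Hamiltonian vector field of $H_2-\langle\mathbf J,(\xi,\eta)\rangle$, induced on the symplectic slice $\ker d\mathbf J(p)/(\mathfrak g_\mu\cdot p)$, has an eigenvalue with positive real part. *)

theory Defs
  imports "HOL-Analysis.Analysis"
begin

type_synonym vec3 = "real^3"
type_synonym mat3 = "real^3^3"

text \<open>
  Cotangent (and tangent) spaces of \<open>Q\<close> are trivialised by body coordinates: a tangent vector at
  \<open>(B, R)\<close> is a pair \<open>(\<Omega>, dR)\<close> standing for the velocity \<open>(B hat(\<Omega>), dR)\<close>, a covector is a pair
  \<open>(\<pi>, p)\<close>, and the duality pairing is the inner product of pairs.  A phase point is \<open>((B, R), (\<pi>, p))\<close>;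
  a tangent vector to the phase space is \<open>((a, dR), (d\<pi>, dp))\<close>, standing for
  \<open>((B hat(a), dR), (d\<pi>, dp))\<close>.
\<close>

type_synonym config = "mat3 \<times> vec3"
type_synonym tvec = "vec3 \<times> vec3"
type_synonym phase = "config \<times> tvec"
type_synonym phase_tvec = "tvec \<times> tvec"
type_synonym lie_alg = "vec3 \<times> real"
type_synonym group_elt = "mat3 \<times> mat3"

definition hat :: "vec3 \<Rightarrow> mat3" where
  "hat \<Omega> = matrix (\<lambda>u. cross3 \<Omega> u)"

lemma hat_eq:
  "hat \<Omega> = vector [vector [0, - \<Omega>$3, \<Omega>$2], vector [\<Omega>$3, 0, - \<Omega>$1], vector [- \<Omega>$2, \<Omega>$1, 0]]"
  by (simp add: hat_def matrix_def cross3_def vec_eq_iff forall_3 axis_def)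

lemma hat_vec: "hat \<Omega> *v u = cross3 \<Omega> u"
  by (simp add: hat_eq cross3_def vec_eq_iff forall_3 matrix_vector_mult_def sum_3)

definition e1 :: vec3 where
  "e1 = axis 1 1"

definition SO3 :: "mat3 set" where
  "SO3 = {B. rotation_matrix B}"

definition config_space :: "config set" where
  "config_space = SO3 \<times> (- {0})"

definition phase_space :: "phase set" where
  "phase_space = config_space \<times> UNIV"

definition embed_tangent :: "phase \<Rightarrow> phase_tvec \<Rightarrow> phase" where
  "embed_tangent z X = ((fst (fst z) ** hat (fst (fst X)), snd (fst X)), snd X)"


section \<open>The Hamiltonian\<close>

definition inertia :: "real \<Rightarrow> real \<Rightarrow> mat3" where
  "inertia I\<^sub>1 I\<^sub>2 = vector [vector [I\<^sub>1, 0, 0], vector [0, I\<^sub>2, 0], vector [0, 0, I\<^sub>2]]"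

definition kinetic :: "mat3 \<Rightarrow> config \<Rightarrow> tvec \<Rightarrow> real" where
  "kinetic I q v = (case (q, v) of ((B, R), (\<Omega>, dR)) \<Rightarrow>
     (\<Omega> \<bullet> (I *v \<Omega>) + (norm (dR + cross3 \<Omega> R))\<^sup>2) / 2)"

definition potential :: "mat3 \<Rightarrow> vec3 \<Rightarrow> real" where
  "potential I R = - 1 / norm R - 1 / (2 * norm R ^ 3) + 3 / (2 * norm R ^ 5) * (R \<bullet> (I *v R))"

definition legendre :: "mat3 \<Rightarrow> config \<Rightarrow> tvec \<Rightarrow> tvec" where
  "legendre I q v = (case (q, v) of ((B, R), (\<Omega>, dR)) \<Rightarrow>
     (I *v \<Omega> + cross3 R (dR + cross3 \<Omega> R), dR + cross3 \<Omega> R))"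

lemma legendre_is_fibre_derivative:
  assumes "transpose I = I"
  shows "(kinetic I q has_derivative (\<lambda>w. legendre I q v \<bullet> w)) (at v)"
proof (cases q)
  case (Pair B R)
  obtain \<Omega> dR where v: "v = (\<Omega>, dR)" by (cases v)
  have sym: "x \<bullet> (I *v y) = y \<bullet> (I *v x)" for x y
    by (metis assms dot_lmul_matrix inner_commute transpose_matrix_vector)
  have bl: "bounded_linear (\<lambda>x. I *v x)" "bounded_linear (\<lambda>x. cross3 x R)"
    by (auto intro!: linear_conv_bounded_linear[THEN iffD1] linearI
        simp: algebra_simps cross_add_left cross_mult_left matrix_vector_mult_scaleR)
  have "((\<lambda>w. (fst w \<bullet> (I *v fst w) + (snd w + cross3 (fst w) R) \<bullet> (snd w + cross3 (fst w) R)) / 2)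
     has_derivative (\<lambda>w. (fst v \<bullet> (I *v fst w) + fst w \<bullet> (I *v fst v)
        + 2 * ((snd v + cross3 (fst v) R) \<bullet> (snd w + cross3 (fst w) R))) / 2)) (at v)"
    by (auto intro!: derivative_eq_intros bounded_linear.has_derivative[OF bl(1)]
        bounded_linear.has_derivative[OF bl(2)] simp: inner_commute fun_eq_iff)
  moreover have "kinetic I q = (\<lambda>w. (fst w \<bullet> (I *v fst w)
      + (snd w + cross3 (fst w) R) \<bullet> (snd w + cross3 (fst w) R)) / 2)"
    by (auto simp: kinetic_def Pair power2_norm_eq_inner)
  moreover have "(fst v \<bullet> (I *v fst w) + fst w \<bullet> (I *v fst v)
        + 2 * ((snd v + cross3 (fst v) R) \<bullet> (snd w + cross3 (fst w) R))) / 2 = legendre I q v \<bullet> w" for w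
  proof -
    have "cross3 R m \<bullet> a = m \<bullet> cross3 a R" for m a
      by (simp add: cross3_simps)
    then show ?thesis
      using sym[of "fst v" "fst w"]
      by (cases w) (simp add: legendre_def Pair v inner_add_left inner_add_right inner_commute)
  qed
  ultimately show ?thesis by simp
qed

definition hamiltonian :: "mat3 \<Rightarrow> phase \<Rightarrow> real" where
  "hamiltonian I z = kinetic I (fst z) (inv (legendre I (fst z)) (snd z)) + potential I (snd (fst z))"

lemma bij_legendre:
  assumes "invertible I"
  shows "bij (legendre I q)"
proof (cases q)
  case (Pair B R)
  obtain J where "I ** J = mat 1" "J ** I = mat 1"
    using assms unfolding invertible_def by blast
  then have i: "J *v (I *v x) = x" "I *v (J *v x) = x" for x
    by (simp_all add: matrix_vector_mul_assoc)
  let ?g = "\<lambda>\<alpha>. let \<Omega> = J *v (fst \<alpha> - cross3 R (snd \<alpha>)) in (\<Omega>, snd \<alpha> - cross3 \<Omega> R)"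
  show ?thesis
    by (rule o_bij[of ?g]) (auto simp: legendre_def Pair Let_def i fun_eq_iff)
qed


section \<open>Hamiltonian vector fields and evolution\<close>

text \<open>
  The canonical form \<open>- d\<theta>\<close> in the left trivialisation; the last term comes from
  \<open>d\<theta>(X, Y) = X \<theta>(Y) - Y \<theta>(X) - \<theta>([X, Y])\<close> for left invariant \<open>X\<close>, \<open>Y\<close> on the rotation group.
\<close>

definition symplectic_form :: "phase \<Rightarrow> phase_tvec \<Rightarrow> phase_tvec \<Rightarrow> real" where
  "symplectic_form z X Y =
     fst X \<bullet> snd Y - snd X \<bullet> fst Y + fst (snd z) \<bullet> cross3 (fst (fst X)) (fst (fst Y))"

text \<open>
  The functions used below are given by formulas that are smooth on the open set \<open>R \<noteq> 0\<close> of the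
  ambient vector space, so derivatives along the phase space are ambient Frechet derivatives
  composed with \<^const>\<open>embed_tangent\<close>.
\<close>

definition tangent_derivative ::
    "(phase \<Rightarrow> 'b::real_normed_vector) \<Rightarrow> phase \<Rightarrow> phase_tvec \<Rightarrow> 'b" where
  "tangent_derivative f z X = frechet_derivative f (at z) (embed_tangent z X)"

definition ham_vf :: "(phase \<Rightarrow> real) \<Rightarrow> phase \<Rightarrow> phase_tvec" where
  "ham_vf F z = (THE X. \<forall>Y. symplectic_form z X Y = tangent_derivative F z Y)"

definition evolution :: "mat3 \<Rightarrow> (real \<Rightarrow> phase) \<Rightarrow> bool" where
  "evolution I \<gamma> \<longleftrightarrow> (\<forall>t. \<gamma> t \<in> phase_space \<and>
     (\<gamma> has_vector_derivative embed_tangent (\<gamma> t) (ham_vf (hamiltonian I) (\<gamma> t))) (at t))"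


section \<open>The symmetry group\<close>

definition block :: "real \<Rightarrow> real^2^2 \<Rightarrow> mat3" where
  "block s O2 = vector [vector [s, 0, 0],
                        vector [0, O2$1$1, O2$1$2],
                        vector [0, O2$2$1, O2$2$2]]"

definition Gamma_axi :: "mat3 set" where
  "Gamma_axi = {block s O2 | s O2. s \<in> {1, -1} \<and> orthogonal_matrix O2}"

text \<open>Determinant of the lower right block.\<close>

definition chi :: "mat3 \<Rightarrow> real" where
  "chi N = N$2$2 * N$3$3 - N$2$3 * N$3$2"

lemma chi_block: "chi (block s O2) = det O2"
  by (simp add: chi_def block_def det_2)

definition G_axi :: "group_elt set" where
  "G_axi = SO3 \<times> Gamma_axi"

definition act_config :: "group_elt \<Rightarrow> config \<Rightarrow> config" where
  "act_config g q = (case (g, q) of ((M, N), (B, R)) \<Rightarrow>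
     (det N *\<^sub>R (M ** B ** transpose N), N *v R))"

text \<open>Tangent map of the action in body coordinates; it does not depend on the base point.\<close>

definition act_tangent :: "group_elt \<Rightarrow> tvec \<Rightarrow> tvec" where
  "act_tangent g v = (case (g, v) of ((M, N), (\<Omega>, dR)) \<Rightarrow> (det N *\<^sub>R (N *v \<Omega>), N *v dR))"

text \<open>The action on covectors is given by the same formula, since it preserves the inner product.\<close>

definition act_phase :: "group_elt \<Rightarrow> phase \<Rightarrow> phase" where
  "act_phase g z = (act_config g (fst z), act_tangent g (snd z))"

lemma act_tangent_body:
  assumes "orthogonal_matrix N"
  shows "det N *\<^sub>R (M ** (B ** hat \<Omega>) ** transpose N) =
         fst (act_config (M, N) (B, R)) ** hat (fst (act_tangent (M, N) (\<Omega>, dR)))"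
proof -
  have NN: "transpose N ** N = mat 1" "N ** transpose N = mat 1"
    using assms by (auto simp add: orthogonal_matrix_def)
  have dd: "det N * det N = 1"
    using det_orthogonal_matrix[OF assms] by auto
  have "(transpose N ** hat (det N *\<^sub>R (N *v \<Omega>))) *v u = (hat \<Omega> ** transpose N) *v u" for u
  proof -
    define w where "w = transpose N *v u"
    have u: "u = N *v w"
      by (simp only: w_def matrix_vector_mul_assoc NN matrix_vector_mul_lid)
    have w: "transpose N *v (N *v x) = x" for x
      by (simp only: matrix_vector_mul_assoc NN matrix_vector_mul_lid)
    have "cross3 (det N *\<^sub>R (N *v \<Omega>)) u = N *v cross3 \<Omega> w"
      by (simp add: u cross_mult_left cross_orthogonal_matrix[OF assms] dd)
    then have "transpose N *v cross3 (det N *\<^sub>R (N *v \<Omega>)) u = cross3 \<Omega> (transpose N *v u)"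
      by (simp only: w w_def[symmetric])
    then show ?thesis
      by (simp only: matrix_vector_mul_assoc[symmetric] hat_vec)
  qed
  then have "transpose N ** hat (det N *\<^sub>R (N *v \<Omega>)) = hat \<Omega> ** transpose N"
    by (simp add: matrix_eq)
  then show ?thesis
    by (simp add: act_config_def act_tangent_def scalar_matrix_assoc[symmetric] matrix_mul_assoc)
       (metis matrix_mul_assoc)
qed

lemma act_tangent_cotangent:
  assumes "orthogonal_matrix N"
  shows "act_tangent (M, N) \<alpha> \<bullet> act_tangent (M, N) v = \<alpha> \<bullet> v"
proof -
  have "det N * det N = 1"
    using det_orthogonal_matrix[OF assms] by auto
  moreover have "(N *v x) \<bullet> (N *v y) = x \<bullet> y" for x y
    using assms orthogonal_transformation_matrix[of "(*v) N"]
    by (simp add: orthogonal_transformation_def)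
  ultimately show ?thesis
    by (cases \<alpha>; cases v) (simp add: act_tangent_def)
qed

definition mexp :: "mat3 \<Rightarrow> mat3" where
  "mexp A = (\<Sum>n. (1 / fact n) *\<^sub>R (((**) A) ^^ n) (mat 1))"

lemma linear_mult_left: "linear (\<lambda>X. (A::mat3) ** (X::mat3))"
  by (rule linearI)
     (simp_all add: matrix_matrix_mult_def vec_eq_iff sum_distrib_left sum.distrib algebra_simps)

lemma linear_mult_right: "linear (\<lambda>X. (X::mat3) ** (A::mat3))"
  by (rule linearI)
     (simp_all add: matrix_matrix_mult_def vec_eq_iff sum_distrib_left sum.distrib algebra_simps)

lemma mexp_0: "mexp 0 = mat 1"
proof -
  have "mexp 0 = (\<Sum>n\<in>{0}. (1 / fact n) *\<^sub>R (((**) 0) ^^ n) (mat 1))"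
    unfolding mexp_def
  proof (rule suminf_finite)
    fix n :: nat assume "n \<notin> {0}"
    then obtain m where "n = Suc m" by (cases n) auto
    then show "(1 / fact n) *\<^sub>R (((**) (0::mat3)) ^^ n) (mat 1) = 0"
      using linear_0[OF linear_mult_right] by simp
  qed simp
  then show ?thesis by simp
qed

lemma mexp_derivative_0: "((\<lambda>t. mexp (t *\<^sub>R A)) has_vector_derivative A) (at 0)"
proof -
  define P where "P n = (((**) A) ^^ n) (mat 1)" for n
  have "bounded_linear (\<lambda>X::mat3. A ** X)"
    using linear_mult_left[of A] by (simp only: linear_conv_bounded_linear)
  from bounded_linear.pos_bounded[OF this]
  obtain K where K: "K > 0" "\<And>X::mat3. norm (A ** X) \<le> norm X * K"
    by auto
  define b where "b n = (1 / fact n) * K ^ n * norm (mat 1 :: mat3)" for n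
  have normP: "norm (P n) \<le> K ^ n * norm (mat 1 :: mat3)" for n
  proof (induction n)
    case (Suc n)
    have "norm (P (Suc n)) \<le> norm (P n) * K"
      using K(2)[of "P n"] by (simp add: P_def)
    also have "\<dots> \<le> K ^ n * norm (mat 1 :: mat3) * K"
      using Suc K(1) by (intro mult_right_mono) auto
    finally show ?case by (simp add: mult_ac)
  qed (simp add: P_def)
  have pow: "(((**) (t *\<^sub>R A)) ^^ n) (mat 1) = t ^ n *\<^sub>R P n" for t n
    by (induction n) (simp_all add: P_def linear_cmul[OF linear_mult_left]
        scalar_matrix_assoc[symmetric])
  define f where "f t n = (1 / fact n) *\<^sub>R (t ^ n *\<^sub>R P n)" for t n
  have mf: "mexp (t *\<^sub>R A) = (\<Sum>n. f t n)" for t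
    by (simp add: mexp_def f_def pow)
  have fb: "norm (f t n) \<le> \<bar>t\<bar> ^ n * b n" for t n
    using mult_left_mono[OF normP, of "\<bar>t\<bar> ^ n / fact n" n]
    by (simp add: f_def b_def power_abs mult_ac)
  have "summable (\<lambda>n. inverse (fact n) * K ^ n)"
    using summable_exp[of K] by simp
  then have sb: "summable b"
    unfolding b_def by (intro summable_mult2) (simp add: field_simps)
  then have sb2: "summable (\<lambda>n. b (n + 2))"
    by (subst summable_iff_shift)
  define C where "C = (\<Sum>n. b (n + 2))"
  have f1: "f t 0 = mat 1" "f t 1 = t *\<^sub>R A" for t
    by (simp_all add: f_def P_def)
  have est: "norm (mexp (t *\<^sub>R A) - mat 1 - t *\<^sub>R A) \<le> t\<^sup>2 * C" if "\<bar>t\<bar> \<le> 1" for t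
  proof -
    have le: "norm (f t (n + 2)) \<le> t\<^sup>2 * b (n + 2)" for n
    proof -
      have "\<bar>t\<bar> ^ (n + 2) \<le> t\<^sup>2"
        using power_decreasing[of 2 "n + 2" "\<bar>t\<bar>"] that by (simp del: power_Suc)
      moreover have "0 \<le> b (n + 2)"
        using K(1) by (simp add: b_def)
      ultimately show ?thesis
        by (rule order_trans[OF fb mult_right_mono])
    qed
    have s2: "summable (\<lambda>n. norm (f t (n + 2)))"
      by (rule summable_comparison_test'[OF summable_mult[OF sb2, of "t\<^sup>2"], of 0]) (use le in simp)
    have "summable (f t)"
      using summable_norm_cancel[OF s2] by (subst (asm) summable_iff_shift)
    then have "mexp (t *\<^sub>R A) = (\<Sum>n. f t (n + 2)) + (\<Sum>n<2. f t n)"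
      unfolding mf by (rule suminf_split_initial_segment)
    then have "mexp (t *\<^sub>R A) - mat 1 - t *\<^sub>R A = (\<Sum>n. f t (n + 2))"
      using f1 by (simp add: numeral_2_eq_2)
    also have "norm \<dots> \<le> (\<Sum>n. norm (f t (n + 2)))"
      by (rule summable_norm[OF s2])
    also have "\<dots> \<le> (\<Sum>n. t\<^sup>2 * b (n + 2))"
      by (rule suminf_le[OF le s2 summable_mult[OF sb2]])
    also have "\<dots> = t\<^sup>2 * C"
      unfolding C_def by (rule suminf_mult[OF sb2])
    finally show ?thesis .
  qed
  show ?thesis
    unfolding has_vector_derivative_def
  proof (rule has_derivativeI_sandwich[of 1 _ _ _ _ "\<lambda>t. \<bar>t\<bar> * C"])
    show "bounded_linear (\<lambda>t. t *\<^sub>R A)"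
      by (rule bounded_linear_scaleR_left)
    show "((\<lambda>t. \<bar>t\<bar> * C) \<longlongrightarrow> 0) (at 0)"
      by (auto intro!: tendsto_eq_intros)
    fix t :: real assume t: "t \<noteq> 0" "dist t 0 < 1"
    have "norm (mexp (t *\<^sub>R A) - mexp (0 *\<^sub>R A) - (t - 0) *\<^sub>R A) \<le> (\<bar>t\<bar> * C) * \<bar>t\<bar>"
    proof -
      have "t\<^sup>2 * C = (\<bar>t\<bar> * C) * \<bar>t\<bar>"
        by (simp add: power2_eq_square)
      moreover have "norm (mexp (t *\<^sub>R A) - mat 1 - t *\<^sub>R A) \<le> t\<^sup>2 * C"
        using est[of t] t(2) by simp
      ultimately show ?thesis
        by (simp only: mexp_0 scaleR_zero_left diff_zero)
    qed
    then show "norm (mexp (t *\<^sub>R A) - mexp (0 *\<^sub>R A) - (t - 0) *\<^sub>R A) / norm (t - 0) \<le> \<bar>t\<bar> * C"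
      using t by (simp add: divide_le_eq)
  qed simp
qed

definition one_param :: "lie_alg \<Rightarrow> real \<Rightarrow> group_elt" where
  "one_param \<zeta> t = (mexp (t *\<^sub>R hat (fst \<zeta>)), mexp ((t * snd \<zeta>) *\<^sub>R hat e1))"

definition config_generator :: "lie_alg \<Rightarrow> config \<Rightarrow> tvec" where
  "config_generator \<zeta> q = (case (\<zeta>, q) of ((\<xi>, \<eta>), (B, R)) \<Rightarrow>
     (transpose B *v \<xi> - \<eta> *\<^sub>R e1, \<eta> *\<^sub>R cross3 e1 R))"

definition phase_generator :: "lie_alg \<Rightarrow> phase \<Rightarrow> phase_tvec" where
  "phase_generator \<zeta> z = (config_generator \<zeta> (fst z),
     (snd \<zeta> *\<^sub>R cross3 e1 (fst (snd z)), snd \<zeta> *\<^sub>R cross3 e1 (snd (snd z))))"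

lemma phase_generator:
  assumes "z \<in> phase_space"
  shows "((\<lambda>t. act_phase (one_param \<zeta> t) z) has_vector_derivative
           embed_tangent z (phase_generator \<zeta> z)) (at 0)"
proof -
  obtain B R \<pi> p \<xi> \<eta> where z: "z = ((B, R), (\<pi>, p))" and \<zeta>: "\<zeta> = (\<xi>, \<eta>)"
    by (metis surj_pair)
  define M where "M t = mexp (t *\<^sub>R hat \<xi>)" for t
  define N where "N t = mexp (t *\<^sub>R (\<eta> *\<^sub>R hat e1))" for t
  have M0: "M 0 = mat 1" and N0: "N 0 = mat 1"
    by (simp_all add: M_def N_def mexp_0)
  have M': "(M has_vector_derivative hat \<xi>) (at 0)"
    and N': "(N has_vector_derivative \<eta> *\<^sub>R hat e1) (at 0)"
    unfolding M_def N_def by (rule mexp_derivative_0)+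
  have ent: "((\<lambda>t. N t $ i $ j) has_real_derivative (\<eta> *\<^sub>R hat e1) $ i $ j) (at 0)" for i j
    using bounded_linear.has_vector_derivative[OF
        bounded_linear_compose[OF bounded_linear_vec_nth bounded_linear_vec_nth] N', of i j]
    by (simp add: has_real_derivative_iff_has_vector_derivative)
  have det': "((\<lambda>t. det (N t)) has_vector_derivative 0) (at 0)"
    unfolding det_3 has_real_derivative_iff_has_vector_derivative[symmetric]
    by (rule derivative_eq_intros ent refl)+ (simp add: N0 mat_def hat_eq)
  have tr': "((\<lambda>t. transpose (N t)) has_vector_derivative transpose (\<eta> *\<^sub>R hat e1)) (at 0)"
    by (rule bounded_linear.has_vector_derivative[OF _ N'])
       (simp add: linear_conv_bounded_linear[symmetric] linearI transpose_def vec_eq_iff)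
  have vN: "((\<lambda>t. N t *v x) has_vector_derivative \<eta> *\<^sub>R cross3 e1 x) (at 0)" for x
  proof -
    have "bounded_linear (\<lambda>A::mat3. A *v x)"
      by (auto simp: linear_conv_bounded_linear[symmetric] algebra_simps
          scaleR_matrix_vector_assoc intro!: linearI)
    from bounded_linear.has_vector_derivative[OF this N']
    show ?thesis by (simp add: scaleR_matrix_vector_assoc[symmetric] hat_vec)
  qed
  have mm: "bounded_bilinear ((**) :: mat3 \<Rightarrow> mat3 \<Rightarrow> mat3)"
    by (simp add: bilinear_conv_bounded_bilinear[symmetric] bilinear_def linear_mult_left
        linear_mult_right)
  have MB: "((\<lambda>t. M t ** B) has_vector_derivative hat \<xi> ** B) (at 0)"
    using bounded_linear.has_vector_derivative[OF _ M', of "\<lambda>A. A ** B"]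
    by (simp add: linear_conv_bounded_linear[symmetric] linear_mult_right)
  have "rotation_matrix B"
    using assms by (simp add: z phase_space_def config_space_def SO3_def)
  then have B: "orthogonal_matrix B" "det B = 1"
    by (auto simp: rotation_matrix_def)
  have BB: "hat \<xi> ** B = B ** hat (transpose B *v \<xi>)"
  proof -
    have "(hat \<xi> ** B) *v u = (B ** hat (transpose B *v \<xi>)) *v u" for u
    proof -
      have "B *v (transpose B *v \<xi>) = \<xi>"
        using B by (simp only: matrix_vector_mul_assoc orthogonal_matrix_def matrix_vector_mul_lid)
      then show ?thesis
        using cross_orthogonal_matrix[OF B(1), of "transpose B *v \<xi>" u] B(2)
        by (simp only: matrix_vector_mul_assoc[symmetric] hat_vec) simp
    qed
    then show ?thesis by (simp add: matrix_eq)
  qed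
  have "((\<lambda>t. M t ** B ** transpose (N t)) has_vector_derivative
      (M 0 ** B ** transpose (\<eta> *\<^sub>R hat e1) + hat \<xi> ** B ** transpose (N 0))) (at 0)"
    by (rule bounded_bilinear.has_vector_derivative[OF mm MB tr'])
  from bounded_bilinear.has_vector_derivative[OF bounded_bilinear_scaleR det' this]
  have "((\<lambda>t. det (N t) *\<^sub>R (M t ** B ** transpose (N t))) has_vector_derivative
      B ** transpose (\<eta> *\<^sub>R hat e1) + hat \<xi> ** B) (at 0)"
    by (simp add: N0 M0 transpose_mat)
  moreover have "B ** transpose (\<eta> *\<^sub>R hat e1) + hat \<xi> ** B = B ** hat (transpose B *v \<xi> - \<eta> *\<^sub>R e1)"
  proof -
    have "transpose (\<eta> *\<^sub>R hat e1) + hat (transpose B *v \<xi>) = hat (transpose B *v \<xi> - \<eta> *\<^sub>R e1)"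
      by (simp add: hat_eq transpose_def vec_eq_iff forall_3)
    then show ?thesis
      by (simp add: BB matrix_add_ldistrib[symmetric])
  qed
  moreover have "((\<lambda>t. det (N t) *\<^sub>R (N t *v \<pi>)) has_vector_derivative \<eta> *\<^sub>R cross3 e1 \<pi>) (at 0)"
    using bounded_bilinear.has_vector_derivative[OF bounded_bilinear_scaleR det' vN]
    by (simp add: N0)
  ultimately have "((\<lambda>t. ((det (N t) *\<^sub>R (M t ** B ** transpose (N t)), N t *v R),
                        (det (N t) *\<^sub>R (N t *v \<pi>), N t *v p))) has_vector_derivative
      ((B ** hat (transpose B *v \<xi> - \<eta> *\<^sub>R e1), \<eta> *\<^sub>R cross3 e1 R),
       (\<eta> *\<^sub>R cross3 e1 \<pi>, \<eta> *\<^sub>R cross3 e1 p))) (at 0)"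
    by (intro has_vector_derivative_Pair vN) (simp_all only:)
  moreover have "act_phase (one_param \<zeta> t) z =
      ((det (N t) *\<^sub>R (M t ** B ** transpose (N t)), N t *v R),
       (det (N t) *\<^sub>R (N t *v \<pi>), N t *v p))" for t
    by (simp add: act_phase_def act_config_def act_tangent_def one_param_def z \<zeta> M_def N_def)
  ultimately show ?thesis
    by (simp add: z \<zeta> embed_tangent_def phase_generator_def config_generator_def)
qed

text \<open>The momentum map is characterised by \<open>momentum (q, \<alpha>) \<bullet> \<zeta> = \<alpha> \<bullet> config_generator \<zeta> q\<close>.\<close>

definition momentum :: "phase \<Rightarrow> lie_alg" where
  "momentum z = adjoint (\<lambda>\<zeta>. config_generator \<zeta> (fst z)) (snd z)"

lemma momentum_eq:
  "momentum ((B, R), (\<pi>, p)) = (B *v \<pi>, (cross3 R p - \<pi>) \<bullet> e1)"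
proof -
  let ?f = "\<lambda>\<zeta>. config_generator \<zeta> (B, R)"
  have lin: "linear ?f"
    by (rule linearI) (auto simp: config_generator_def algebra_simps
        matrix_vector_mult_scaleR cross_add_right cross_mult_right
        vector_scaleR_matrix_ac scaleR_vector_matrix_assoc split: prod.splits)
  have "momentum ((B, R), (\<pi>, p)) \<bullet> \<zeta> = (B *v \<pi>, (cross3 R p - \<pi>) \<bullet> e1) \<bullet> \<zeta>" for \<zeta>
  proof (cases \<zeta>)
    case (Pair \<xi> \<eta>)
    have "momentum ((B, R), (\<pi>, p)) \<bullet> \<zeta> = ?f \<zeta> \<bullet> (\<pi>, p)"
      using adjoint_works[OF lin, of \<zeta> "(\<pi>, p)"] by (simp add: momentum_def inner_commute)
    moreover have "(transpose B *v \<xi>) \<bullet> \<pi> = (B *v \<pi>) \<bullet> \<xi>"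
      by (metis dot_lmul_matrix inner_commute transpose_matrix_vector)
    moreover have "cross3 e1 R \<bullet> p = cross3 R p \<bullet> e1"
      by (simp add: cross3_simps)
    ultimately show ?thesis
      by (simp add: Pair config_generator_def inner_diff_left inner_commute algebra_simps)
  qed
  then show ?thesis
    using vector_eq_rdot by blast
qed

definition coadjoint :: "group_elt \<Rightarrow> lie_alg \<Rightarrow> lie_alg" where
  "coadjoint g \<mu> = (fst g *v fst \<mu>, chi (snd g) * snd \<mu>)"

definition stabilizer :: "lie_alg \<Rightarrow> group_elt set" where
  "stabilizer \<mu> = {g \<in> G_axi. coadjoint g \<mu> = \<mu>}"

definition stabilizer_alg :: "lie_alg \<Rightarrow> lie_alg set" where
  "stabilizer_alg \<mu> = {\<zeta>. \<forall>t. one_param \<zeta> t \<in> stabilizer \<mu>}"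


section \<open>Relative equilibria and their stability\<close>

definition relative_equilibrium :: "mat3 \<Rightarrow> phase \<Rightarrow> lie_alg \<Rightarrow> bool" where
  "relative_equilibrium I p \<zeta> \<longleftrightarrow> evolution I (\<lambda>t. act_phase (one_param \<zeta> t) p)"

definition phase_point :: "mat3 \<Rightarrow> config \<Rightarrow> lie_alg \<Rightarrow> phase" where
  "phase_point I q \<zeta> = (q, legendre I q (config_generator \<zeta> q))"

definition phase_nbhd :: "phase set \<Rightarrow> phase set \<Rightarrow> bool" where
  "phase_nbhd U A \<longleftrightarrow> U \<subseteq> phase_space \<and>
     (\<exists>V. openin (top_of_set phase_space) V \<and> A \<subseteq> V \<and> V \<subseteq> U)"

text \<open>``Stays in \<open>U\<close> for all time'' includes that the evolution exists for all (positive and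
  negative) times.\<close>

definition Gmu_stable :: "mat3 \<Rightarrow> phase \<Rightarrow> bool" where
  "Gmu_stable I p \<longleftrightarrow> (let G\<mu> = stabilizer (momentum p) in
     \<forall>U. phase_nbhd U ((\<lambda>g. act_phase g p) ` G\<mu>) \<and> (\<forall>g\<in>G\<mu>. act_phase g ` U \<subseteq> U) \<longrightarrow>
       (\<exists>W. phase_nbhd W {p} \<and>
         (\<forall>z\<in>W. (\<exists>\<gamma>. evolution I \<gamma> \<and> \<gamma> 0 = z) \<and>
                 (\<forall>\<gamma>. evolution I \<gamma> \<and> \<gamma> 0 = z \<longrightarrow> (\<forall>t. \<gamma> t \<in> U)))))"

text \<open>
  Linearisation of a vector field at a zero, in the trivialisation of the tangent bundle; at a zero
  the derivative of the frame does not contribute.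
\<close>

definition augmented_linearization :: "mat3 \<Rightarrow> phase \<Rightarrow> lie_alg \<Rightarrow> phase_tvec \<Rightarrow> phase_tvec" where
  "augmented_linearization I p \<zeta> =
     tangent_derivative (ham_vf (\<lambda>z. hamiltonian I z - momentum z \<bullet> \<zeta>)) p"

text \<open>
  \<open>s\<close> is an eigenvalue of the complexification of the map induced by \<open>L\<close> on \<open>V / W\<close>, with
  eigenvector the class of \<open>u + \<i> w\<close>.
\<close>

definition quotient_eigenvalue ::
    "('a::real_vector \<Rightarrow> 'a) \<Rightarrow> 'a set \<Rightarrow> 'a set \<Rightarrow> complex \<Rightarrow> bool" where
  "quotient_eigenvalue L V W s \<longleftrightarrow>
     (\<exists>u\<in>V. \<exists>w\<in>V. \<not> (u \<in> W \<and> w \<in> W) \<and>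
        L u - (Re s *\<^sub>R u - Im s *\<^sub>R w) \<in> W \<and>
        L w - (Im s *\<^sub>R u + Re s *\<^sub>R w) \<in> W)"

definition unstable :: "mat3 \<Rightarrow> phase \<Rightarrow> lie_alg \<Rightarrow> bool" where
  "unstable I p \<zeta> \<longleftrightarrow>
     (\<exists>s. Re s > 0 \<and>
        quotient_eigenvalue (augmented_linearization I p \<zeta>)
          {X. tangent_derivative momentum p X = 0}
          ((\<lambda>\<zeta>'. phase_generator \<zeta>' p) ` stabilizer_alg (momentum p))
          s)"

end

theory Submission
  imports Defs
begin

text \<open>
  The axial spin \<open>(\<pi> - R \<times> p)\<^sub>1\<close> of the equilibrium vanishes, and on its zero level the energy is a sum of
  squares, a multiple of \<open>(I\<^sub>2 - I\<^sub>1) (R\<^sub>2\<^sup>2 + R\<^sub>3\<^sup>2)\<close>, and the amended potential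
  \<open>W(r) = |\<pi>|\<^sup>2 / (2 (I\<^sub>2 + r\<^sup>2)) - 1/r - (1 - 3 I\<^sub>1) / (2 r\<^sup>3)\<close>.  The equilibrium is a critical point of \<open>W\<close>,
  and the orbit is large precisely when \<open>W'' > 0\<close> there.

  For a prolate body the common level set of energy and momentum near the equilibrium is therefore
  contained in its \<open>G\<^sub>\<mu>\<close>-orbit, and compactness confines every motion with nearby values of these
  first integrals.  The same confinement yields completeness of these motions, by Picard iteration
  for the vector field precomposed with the projection onto a compact convex set.

  For an oblate body the tangential second derivative of the energy is negative while \<open>W'' > 0\<close>, so the
  motion in the orbital plane, a system with two degrees of freedom, has a quadratic form of odd index
  and hence a positive real eigenvalue.
\<close>

subsection \<open>Global solutions of ordinary differential equations\<close>

text \<open>\<open>Gmu_stable\<close> demands that nearby motions exist for all times, so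
  confinement must be paired with an existence theorem. The obstacle there is that
  \<open>SO3\<close> is neither convex nor open among the matrices. The equations are therefore
  solved in the ambient vector space, inside a convex set with interior, and conservation of
  \<open>B ** transpose B\<close> and of the determinant returns the solution to phase space. Nearby
  motions may have nonzero axial spin and another total momentum, where the splitting into squares
  fails or its minimum has moved. No estimate is made for them: the level set is computed only for
  the values at the equilibrium, and continuity of energy and momentum on a compact set does the
  rest. For instability the eigenvector has to be nonzero in a quotient. A variation that moves the
  position off the symmetry axis is, because at the equilibrium no infinitesimal symmetry moves the
  position. Both cases meet the same number: the second derivative of the amended potential, after
  clearing denominators, is the difference of the two sides of the large orbit condition, and it is
  a factor of the constant term of the characteristic polynomial.\<close>

definition oriented_integral :: "(real \<Rightarrow> 'a::banach) \<Rightarrow> real \<Rightarrow> 'a" where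
  "oriented_integral g t = integral {0..t} g - integral {t..0} g"

lemma oriented_integral_0 [simp]: "oriented_integral g 0 = 0"
  by (simp add: oriented_integral_def)

text \<open>An integral over an empty interval is 0, so only one of the two terms survives for
  either sign of \<open>t\<close>. The fundamental theorem needs a base point on the left: near
  \<open>t\<close> the function differs by a constant from the integral taken from \<open>a\<close>,
  which lies below both \<open>t\<close> and 0.\<close>

lemma oriented_integral_has_vector_derivative:
  assumes "continuous_on UNIV g"
  shows "(oriented_integral g has_vector_derivative g t) (at t)"
proof -
  define a where "a = - \<bar>t\<bar> - 1"
  define b where "b = \<bar>t\<bar> + 1"
  have int: "g integrable_on {u..v}" for u v
    by (rule integrable_continuous_real) (rule continuous_on_subset[OF assms], simp)
  have eq: "oriented_integral g s = integral {a..s} g - integral {a..0} g" if "s \<in> {a<..<b}" for s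
  proof (cases "0 \<le> s")
    case True
    have "integral {a..0} g + integral {0..s} g = integral {a..s} g"
      using True by (intro Henstock_Kurzweil_Integration.integral_combine int) (auto simp: a_def)
    moreover have "integral {s..0} g = 0"
      using True by (cases "s = 0") auto
    ultimately show ?thesis by (simp add: oriented_integral_def algebra_simps)
  next
    case False
    have "integral {a..s} g + integral {s..0} g = integral {a..0} g"
      using False that by (intro Henstock_Kurzweil_Integration.integral_combine int) auto
    then show ?thesis using False by (simp add: oriented_integral_def algebra_simps)
  qed
  have t: "t \<in> {a<..<b}" by (auto simp: a_def b_def)
  have "((\<lambda>s. integral {a..s} g) has_vector_derivative g t) (at t within {a..b})"
    using t by (intro integral_has_vector_derivative continuous_on_subset[OF assms]) auto
  then have "((\<lambda>s. integral {a..s} g) has_vector_derivative g t) (at t within {a<..<b})"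
    by (rule has_vector_derivative_within_subset) auto
  then have "((\<lambda>s. integral {a..s} g) has_vector_derivative g t) (at t)"
    using t by (simp add: has_vector_derivative_at_within at_within_open[OF t])
  then have "((\<lambda>s. integral {a..s} g - integral {a..0} g) has_vector_derivative g t) (at t)"
    by (auto intro!: derivative_eq_intros)
  then show ?thesis
    by (rule has_vector_derivative_transform_within_open[of _ _ _ "{a<..<b}"]) (use t eq in auto)
qed

text \<open>Integrating \<open>c * exp (K * s)\<close> gains the factor \<open>1 / K\<close>, the
  source of the contraction below. Negative times reduce to positive ones by reversing time.\<close>

lemma norm_antiderivative_le_exp:
  fixes G :: "real \<Rightarrow> 'a::real_normed_vector"
  assumes K: "K > 0" and G: "\<And>t. (G has_vector_derivative g t) (at t)" and G0: "G 0 = 0"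
    and g: "\<And>t. norm (g t) \<le> c * exp (K * \<bar>t\<bar>)"
  shows "norm (G t) \<le> c / K * exp (K * \<bar>t\<bar>)"
proof -
  have c: "0 \<le> c" using order_trans[OF norm_ge_zero g[of 0]] by simp
  have pos: "norm (H t) \<le> c / K * exp (K * t)"
    if "0 < t" and H: "\<And>t. (H has_vector_derivative h t) (at t)" and H0: "H 0 = 0"
      and h: "\<And>t. norm (h t) \<le> c * exp (K * \<bar>t\<bar>)"
    for H :: "real \<Rightarrow> 'a" and h and t
  proof -
    have "norm (H t - H 0) \<le> c / K * exp (K * t) - c / K * exp (K * 0)"
    proof (rule differentiable_bound_general[OF \<open>0 < t\<close>])
      show "continuous_on {0..t} H"
        by (meson H continuous_at_imp_continuous_on has_vector_derivative_continuous)
      show "continuous_on {0..t} (\<lambda>t. c / K * exp (K * t))"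
        by (intro continuous_intros)
      show "((\<lambda>t. c / K * exp (K * t)) has_vector_derivative c * exp (K * s)) (at s)" for s
        unfolding has_real_derivative_iff_has_vector_derivative[symmetric]
        using K by (auto intro!: derivative_eq_intros)
      show "norm (h s) \<le> c * exp (K * s)" if "0 < s" for s
        using h[of s] that by simp
    qed (use H in auto)
    moreover have "0 \<le> c / K" using c K by simp
    ultimately show ?thesis using H0 by simp
  qed
  consider "t = 0" | "0 < t" | "0 < - t" by linarith
  then show ?thesis
  proof cases
    case 1
    then show ?thesis using G0 c K by simp
  next
    case 2
    then show ?thesis using pos[of t G g] G G0 g by simp
  next
    case 3
    have "norm ((\<lambda>s. G (- s)) (- t)) \<le> c / K * exp (K * (- t))"
    proof (rule pos[OF 3, of "\<lambda>s. G (- s)" "\<lambda>s. - g (- s)"])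
      show "((\<lambda>s. G (- s)) has_vector_derivative - g (- s)) (at s)" for s
      proof -
        have "(uminus has_vector_derivative - 1) (at s)"
          by (auto intro!: derivative_eq_intros)
        from vector_diff_chain_at[OF this G] show ?thesis by (simp add: o_def)
      qed
      show "norm (- g (- s)) \<le> c * exp (K * \<bar>s\<bar>)" for s
        using g[of "- s"] by simp
    qed (simp add: G0)
    then show ?thesis using 3 by simp
  qed
qed

text \<open>Picard iteration in the norm \<open>sup\<^sub>t exp (- K \<bar>t\<bar>) |x t|\<close>, in which the integral operator
  contracts on the whole time axis as soon as \<open>K\<close> exceeds the Lipschitz constant.\<close>

theorem global_solution_bounded_lipschitz:
  fixes f :: "'a::banach \<Rightarrow> 'a"
  assumes lip: "L-lipschitz_on UNIV f" and bdd: "bounded (range f)"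
  obtains x where "x 0 = x0" "\<And>t. (x has_vector_derivative f (x t)) (at t)"
proof -
  have L0: "0 \<le> L" by (rule lipschitz_on_nonneg[OF lip])
  \<comment> \<open>Gives \<open>L / K \<le> 1 / 2\<close>; the summand 1 keeps \<open>K\<close>
    positive when \<open>L = 0\<close>.\<close>
  define K where "K = 2 * L + 1"
  have K: "K > 0" using L0 by (simp add: K_def)
  obtain M where M: "\<And>x. norm (f x) \<le> M"
    using bdd by (auto simp: bounded_iff)
  have M0: "0 \<le> M" using M[of 0] norm_ge_zero[of "f 0"] by linarith
  \<comment> \<open>The weighted space is modelled on bounded continuous functions: \<open>v\<close>
    encodes the curve \<open>y v\<close>, and the weighted distance of two curves is the sup
    distance of their codes.\<close>
  define y where "y v s = x0 + exp (K * \<bar>s\<bar>) *\<^sub>R apply_bcontfun v s" for v and s :: real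
  define G where "G v = oriented_integral (\<lambda>s. f (y v s))" for v
  have cont: "continuous_on UNIV (\<lambda>s. f (y v s))" for v
  proof (rule continuous_on_compose2[of UNIV f])
    show "continuous_on UNIV f" by (rule lipschitz_on_continuous_on[OF lip])
    show "continuous_on UNIV (y v)" unfolding y_def by (intro continuous_intros continuous_on_apply_bcontfun)
  qed simp
  have G': "(G v has_vector_derivative f (y v t)) (at t)" for v t
    unfolding G_def by (rule oriented_integral_has_vector_derivative[OF cont])
  have G0: "G v 0 = 0" for v by (simp add: G_def)
  have exp_cancel: "exp (- (K * \<bar>t\<bar>)) * (a * exp (K * \<bar>t\<bar>)) = a" for a t
    by (simp add: exp_minus)
  have bcont: "(\<lambda>t. exp (- (K * \<bar>t\<bar>)) *\<^sub>R G v t) \<in> bcontfun" for v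
  proof (rule bcontfun_normI[of _ "M / K"])
    have "continuous_on UNIV (G v)"
      by (meson G' continuous_at_imp_continuous_on has_vector_derivative_continuous)
    then show "continuous_on UNIV (\<lambda>t. exp (- (K * \<bar>t\<bar>)) *\<^sub>R G v t)"
      by (intro continuous_intros)
    have "norm (f (y v s)) \<le> M * exp (K * \<bar>s\<bar>)" for s
    proof -
      have "1 \<le> exp (K * \<bar>s\<bar>)" using K by simp
      then have "M \<le> M * exp (K * \<bar>s\<bar>)" using M0 mult_left_mono[of 1 "exp (K * \<bar>s\<bar>)" M] by simp
      then show ?thesis using M[of "y v s"] by linarith
    qed
    then have "norm (G v t) \<le> M / K * exp (K * \<bar>t\<bar>)" for t
      by (rule norm_antiderivative_le_exp[OF K G' G0])
    from mult_left_mono[OF this, of "exp (- (K * \<bar>t\<bar>))" t for t]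
    show "norm (exp (- (K * \<bar>t\<bar>)) *\<^sub>R G v t) \<le> M / K" for t
      unfolding exp_cancel by simp
  qed
  define T where "T v = Bcontfun (\<lambda>t. exp (- (K * \<bar>t\<bar>)) *\<^sub>R G v t)" for v
  have T: "apply_bcontfun (T v) t = exp (- (K * \<bar>t\<bar>)) *\<^sub>R G v t" for v t
    by (simp add: T_def Bcontfun_inverse[OF bcont])
  have "dist (T v) (T w) \<le> (1/2) * dist v w" for v w
  proof (rule dist_bound)
    fix t
    have "norm ((\<lambda>t. G v t - G w t) t) \<le> (L * dist v w) / K * exp (K * \<bar>t\<bar>)"
    proof (rule norm_antiderivative_le_exp[OF K])
      show "((\<lambda>t. G v t - G w t) has_vector_derivative f (y v s) - f (y w s)) (at s)" for s
        by (intro has_vector_derivative_diff G')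
      fix s
      have "norm (f (y v s) - f (y w s)) \<le> L * dist (y v s) (y w s)"
        using lipschitz_onD[OF lip, of "y v s" "y w s"] by (simp add: dist_norm)
      also have "dist (y v s) (y w s) = exp (K * \<bar>s\<bar>) * dist (apply_bcontfun v s) (apply_bcontfun w s)"
        by (simp add: y_def dist_norm scaleR_right_diff_distrib[symmetric])
      also have "L * \<dots> \<le> L * (exp (K * \<bar>s\<bar>) * dist v w)"
        using L0 by (intro mult_left_mono dist_bounded) auto
      finally show "norm (f (y v s) - f (y w s)) \<le> (L * dist v w) * exp (K * \<bar>s\<bar>)"
        by (simp add: mult_ac)
    qed (simp add: G0)
    from mult_left_mono[OF this, of "exp (- (K * \<bar>t\<bar>))"]
    have "dist (apply_bcontfun (T v) t) (apply_bcontfun (T w) t) \<le> L / K * dist v w"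
      unfolding exp_cancel T by (simp add: dist_norm scaleR_right_diff_distrib[symmetric])
    also have "L / K \<le> 1 / 2" using L0 by (simp add: K_def divide_simps)
    then have "L / K * dist v w \<le> 1 / 2 * dist v w"
      by (rule mult_right_mono) simp
    finally show "dist (apply_bcontfun (T v) t) (apply_bcontfun (T w) t) \<le> 1 / 2 * dist v w" .
  qed
  then obtain v where v: "T v = v"
    using banach_fix_type[of "1/2" T] by auto
  have "y v t = x0 + G v t" for t
  proof -
    have "y v t = x0 + exp (K * \<bar>t\<bar>) *\<^sub>R apply_bcontfun (T v) t" by (simp add: y_def v)
    then show ?thesis by (simp add: T exp_minus)
  qed
  then have y: "y v = (\<lambda>t. x0 + G v t)" by blast
  have "(y v has_vector_derivative f (y v t)) (at t)" for t
    using has_vector_derivative_add[OF has_vector_derivative_const[of x0] G'[of v t]]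
    by (subst y) simp
  moreover have "y v 0 = x0" by (simp add: y G0)
  ultimately show ?thesis using that by blast
qed

text \<open>Composing \<open>f\<close> with the nearest-point projection gives a bounded, globally
  Lipschitz field whose solutions solve the original equation as long as they stay in
  \<open>D\<close>. A first exit is impossible: up to and including that time the curve lies in
  \<open>D\<close>, since \<open>D\<close> is closed, hence by \<open>trapped\<close> in the
  interior, so it stays in \<open>D\<close> a little longer.\<close>

lemma global_solution_trapped:
  fixes f :: "'a::euclidean_space \<Rightarrow> 'a"
  assumes D: "convex D" "compact D" and lip: "L-lipschitz_on D f" and x0: "x0 \<in> D"
    and trapped: "\<And>a b x t. \<lbrakk>a \<le> 0; 0 \<le> b; x 0 = x0; \<And>s. s \<in> {a..b} \<Longrightarrow> x s \<in> D;
        \<And>s. s \<in> {a..b} \<Longrightarrow> (x has_vector_derivative f (x s)) (at s within {a..b}); t \<in> {a..b}\<rbrakk>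
        \<Longrightarrow> x t \<in> interior D"
  obtains x where "x 0 = x0" "\<And>t. x t \<in> D" "\<And>t. (x has_vector_derivative f (x t)) (at t)"
proof -
  define P where "P = closest_point D"
  have cl: "closed D" and ne: "D \<noteq> {}" using D x0 compact_imp_closed by auto
  have PD: "P x \<in> D" for x by (simp add: P_def closest_point_in_set cl ne)
  have Pid: "P x = x" if "x \<in> D" for x by (simp add: P_def closest_point_self that)
  have "1-lipschitz_on UNIV P"
    by (rule lipschitz_onI) (simp_all add: P_def closest_point_lipschitz D cl ne)
  then have lipP: "L-lipschitz_on UNIV (\<lambda>x. f (P x))"
    using lipschitz_on_compose2[of 1 UNIV P L f] lipschitz_on_subset[OF lip] PD by (auto simp: image_subset_iff)
  have "compact (f ` D)"
    using lipschitz_on_continuous_on[OF lip] D(2) by (rule compact_continuous_image)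
  then have "bounded (range (\<lambda>x. f (P x)))"
    by (rule bounded_subset[OF compact_imp_bounded]) (use PD in auto)
  from global_solution_bounded_lipschitz[OF lipP this, of x0] obtain x
    where x: "x 0 = x0" "\<And>t. (x has_vector_derivative f (P (x t))) (at t)" by blast
  have contx: "continuous (at t) x" for t
    using x(2) has_vector_derivative_continuous by blast
  \<comment> \<open>Pairing \<open>t\<close> with \<open>- t\<close> handles exits in both time
    directions by a single infimum.\<close>
  define Bad where "Bad = {t. 0 \<le> t \<and> (x t \<notin> D \<or> x (- t) \<notin> D)}"
  have "Bad = {}"
  proof (rule ccontr)
    assume ne: "Bad \<noteq> {}"
    define \<tau> where "\<tau> = Inf Bad"
    have bdd: "bdd_below Bad" by (rule bdd_belowI[of _ 0]) (simp add: Bad_def)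
    have \<tau>0: "0 \<le> \<tau>" unfolding \<tau>_def by (rule cInf_greatest[OF ne]) (simp add: Bad_def)
    have good: "x s \<in> D" if "\<bar>s\<bar> < \<tau>" for s
    proof -
      have "\<bar>s\<bar> \<notin> Bad" using that cInf_lower[OF _ bdd] unfolding \<tau>_def by force
      then show ?thesis unfolding Bad_def by (cases "0 \<le> s") auto
    qed
    have "{- \<tau>..\<tau>} \<subseteq> x -` D"
    proof (cases "\<tau> = 0")
      case True
      then show ?thesis using x x0 by auto
    next
      case False
      have "closed (x -` D)"
        using continuous_closed_vimage[OF cl] contx by blast
      then have "closure {- \<tau><..<\<tau>} \<subseteq> x -` D"
        by (rule closure_minimal[rotated]) (use good in auto)
      then show ?thesis using False \<tau>0 by simp
    qed
    then have inD: "x s \<in> D" if "s \<in> {- \<tau>..\<tau>}" for s using that by blast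
    have int: "x s \<in> interior D" if "s \<in> {- \<tau>..\<tau>}" for s
    proof (rule trapped[of "- \<tau>" \<tau> x])
      show "(x has_vector_derivative f (x s)) (at s within {- \<tau>..\<tau>})" if "s \<in> {- \<tau>..\<tau>}" for s
        using x(2)[of s] Pid[OF inD[OF that]] has_vector_derivative_at_within by metis
    qed (use \<tau>0 x(1) inD that in auto)
    have "open (x -` interior D)"
      using continuous_open_vimage[OF open_interior] contx by blast
    moreover have "\<tau> \<in> x -` interior D" "- \<tau> \<in> x -` interior D"
      using int \<tau>0 by auto
    ultimately obtain d1 d2 where d: "d1 > 0" "ball \<tau> d1 \<subseteq> x -` interior D"
        "d2 > 0" "ball (- \<tau>) d2 \<subseteq> x -` interior D"
      by (meson open_contains_ball_eq)
    obtain t where t: "t \<in> Bad" "t < \<tau> + min d1 d2"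
      using cInf_lessD[OF ne, of "\<tau> + min d1 d2"] d unfolding \<tau>_def by auto
    have "\<tau> \<le> t" unfolding \<tau>_def by (rule cInf_lower[OF t(1) bdd])
    then have "t \<in> ball \<tau> d1" "- t \<in> ball (- \<tau>) d2" using t by (auto simp: dist_real_def)
    then have "x t \<in> D" "x (- t) \<in> D" using d interior_subset by blast+
    then show False using t(1) by (simp add: Bad_def)
  qed
  then have inD: "x t \<in> D" for t
  proof -
    have "\<bar>t\<bar> \<notin> Bad" using \<open>Bad = {}\<close> by simp
    then show ?thesis unfolding Bad_def by (cases "0 \<le> t") auto
  qed
  then have "(x has_vector_derivative f (x t)) (at t)" for t using x(2)[of t] Pid by simp
  then show ?thesis using that x inD by blast
qed

subsection \<open>The Hamiltonian vector field\<close>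

lemma inertia_mult: "inertia a b *v x = vector [a * x$1, b * x$2, b * x$3]"
  by (simp add: inertia_def vec_eq_iff forall_3 matrix_vector_mult_def sum_3)

lemma inertia_inverse:
  assumes "a \<noteq> 0" "b \<noteq> 0"
  shows "inertia a b *v (inertia (1/a) (1/b) *v x) = x"
  using assms by (simp add: inertia_mult vec_eq_iff forall_3)

lemma inertia_inner: "x \<bullet> (inertia a b *v y) = a * (x$1 * y$1) + b * (x$2 * y$2) + b * (x$3 * y$3)"
  by (simp add: inertia_mult inner_vec_def sum_3)

lemma inertia_symmetric: "x \<bullet> (inertia a b *v y) = y \<bullet> (inertia a b *v x)"
  by (simp add: inertia_inner mult_ac)

lemma invertible_inertia:
  assumes "a \<noteq> 0" "b \<noteq> 0"
  shows "invertible (inertia a b)"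
  using assms by (simp add: invertible_det_nz inertia_def det_3)

lemma bounded_bilinear_cross3: "bounded_bilinear cross3"
  using bilinear_cross bilinear_conv_bounded_bilinear by blast

lemma bounded_bilinear_matrix_vector:
  "bounded_bilinear ((*v) :: real^'n^'m \<Rightarrow> real^'n \<Rightarrow> real^'m)"
  unfolding bilinear_conv_bounded_bilinear[symmetric] bilinear_def
  by (auto intro!: linearI simp: algebra_simps matrix_vector_mult_scaleR
      scaleR_matrix_vector_assoc)

lemma bounded_bilinear_matrix_matrix: "bounded_bilinear ((**) :: mat3 \<Rightarrow> mat3 \<Rightarrow> mat3)"
  unfolding bilinear_conv_bounded_bilinear[symmetric] bilinear_def
  by (simp add: linear_mult_left linear_mult_right)

lemma bounded_linear_hat: "bounded_linear hat"
  unfolding linear_conv_bounded_linear[symmetric]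
  by (rule linearI) (simp_all add: hat_eq vec_eq_iff forall_3)

lemma bounded_linear_transpose: "bounded_linear (transpose :: mat3 \<Rightarrow> mat3)"
  unfolding linear_conv_bounded_linear[symmetric]
  by (rule linearI) (simp_all add: transpose_def vec_eq_iff)

lemmas has_derivative_cross3 [derivative_intros] = bounded_bilinear.FDERIV[OF bounded_bilinear_cross3]
lemmas has_derivative_matrix_vector [derivative_intros] =
  bounded_bilinear.FDERIV[OF bounded_bilinear_matrix_vector]
lemmas has_derivative_matrix_matrix [derivative_intros] =
  bounded_bilinear.FDERIV[OF bounded_bilinear_matrix_matrix]
lemmas has_derivative_transpose [derivative_intros] =
  bounded_linear.has_derivative[OF bounded_linear_transpose]

section \<open>Gradient and Hessian of the potential\<close>

lemma has_derivative_inverse_norm_power: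
  fixes R :: "'a::real_inner"
  assumes "R \<noteq> 0"
  shows "((\<lambda>R. c / norm R ^ n) has_derivative (\<lambda>h. - (n * c * (R \<bullet> h)) / norm R ^ (n + 2))) (at R)"
proof (cases n)
  case 0
  then show ?thesis by simp
next
  case (Suc m)
  have "((\<lambda>R. c / norm R ^ n) has_derivative
      (\<lambda>h. - c * (of_nat n * (h \<bullet> sgn R) * norm R ^ (n - 1)) / (norm R ^ n * norm R ^ n))) (at R)"
    using assms by (auto intro!: derivative_eq_intros has_derivative_norm[THEN has_derivative_eq_rhs] simp: fun_eq_iff)
  moreover have "- c * (of_nat n * (h \<bullet> sgn R) * norm R ^ (n - 1)) / (norm R ^ n * norm R ^ n)
      = - (n * c * (R \<bullet> h)) / norm R ^ (n + 2)" for h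
    using assms by (simp add: Suc sgn_div_norm inner_commute field_simps)
  ultimately show ?thesis by simp
qed

lemma inertia_quadratic_has_derivative:
  "((\<lambda>x. x \<bullet> (inertia a b *v x)) has_derivative (\<lambda>h. 2 * (h \<bullet> (inertia a b *v x)))) (at x)"
  by (auto intro!: derivative_eq_intros simp: inertia_symmetric)

definition grad_potential :: "mat3 \<Rightarrow> vec3 \<Rightarrow> vec3" where
  "grad_potential I R =
     (1 / norm R ^ 3 + (3/2) / norm R ^ 5 - (15/2) / norm R ^ 7 * (R \<bullet> (I *v R))) *\<^sub>R R
       + (3 / norm R ^ 5) *\<^sub>R (I *v R)"

lemma potential_has_derivative:
  assumes "R \<noteq> 0"
  shows "(potential (inertia I\<^sub>1 I\<^sub>2) has_derivative
           (\<lambda>h. grad_potential (inertia I\<^sub>1 I\<^sub>2) R \<bullet> h)) (at R)"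
proof -
  let ?I = "inertia I\<^sub>1 I\<^sub>2"
  have V: "potential ?I = (\<lambda>R. (-1) / norm R ^ 1 + (-1/2) / norm R ^ 3 + (3/2) / norm R ^ 5 * (R \<bullet> (?I *v R)))"
    by (simp add: potential_def fun_eq_iff)
  note N = has_derivative_inverse_norm_power[OF assms]
  show ?thesis
    unfolding V
    by (rule has_derivative_eq_rhs[OF has_derivative_add[OF has_derivative_add[OF N N]
          has_derivative_mult[OF N inertia_quadratic_has_derivative]]])
       (simp add: fun_eq_iff grad_potential_def inner_add_left inner_commute[of _ "?I *v R"]
         algebra_simps add_divide_distrib power3_eq_cube)
qed

definition hess_potential :: "mat3 \<Rightarrow> vec3 \<Rightarrow> vec3 \<Rightarrow> vec3" where
  "hess_potential I R h =
     (1 / norm R ^ 3 + (3/2) / norm R ^ 5 - (15/2) / norm R ^ 7 * (R \<bullet> (I *v R))) *\<^sub>R h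
     + ((105/2) / norm R ^ 9 * (R \<bullet> h) * (R \<bullet> (I *v R)) - 15 / norm R ^ 7 * (h \<bullet> (I *v R))
         - 3 * (R \<bullet> h) / norm R ^ 5 - (15/2) * (R \<bullet> h) / norm R ^ 7) *\<^sub>R R
     + (3 / norm R ^ 5) *\<^sub>R (I *v h) - (15 * (R \<bullet> h) / norm R ^ 7) *\<^sub>R (I *v R)"

lemma grad_potential_has_derivative:
  assumes "R \<noteq> 0"
  shows "(grad_potential (inertia I\<^sub>1 I\<^sub>2) has_derivative hess_potential (inertia I\<^sub>1 I\<^sub>2) R) (at R)"
proof -
  let ?I = "inertia I\<^sub>1 I\<^sub>2"
  have V: "grad_potential ?I = (\<lambda>R. (1 / norm R ^ 3 + (3/2) / norm R ^ 5 - (15/2) / norm R ^ 7 * (R \<bullet> (?I *v R))) *\<^sub>R R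
       + (3 / norm R ^ 5) *\<^sub>R (?I *v R))"
    by (simp add: grad_potential_def fun_eq_iff)
  have L: "((*v) ?I has_derivative (*v) ?I) (at R)"
    by (rule bounded_linear_imp_has_derivative) (rule matrix_vector_mul_bounded_linear)
  note N = has_derivative_inverse_norm_power[OF assms]
  show ?thesis
    unfolding V
    by (rule has_derivative_eq_rhs[OF has_derivative_add[OF
          has_derivative_scaleR[OF has_derivative_diff[OF has_derivative_add[OF N N]
          has_derivative_mult[OF N inertia_quadratic_has_derivative]] has_derivative_ident] has_derivative_scaleR[OF N L]]])
       (simp add: fun_eq_iff hess_potential_def algebra_simps add_divide_distrib)
qed

text \<open>By the Legendre transform, \<pi> - R x p is the spin angular momentum
  \<open>I *v \<Omega>\<close> of the body; inverting the inertia tensor recovers \<Omega>.\<close>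

definition angular_velocity :: "real \<Rightarrow> real \<Rightarrow> phase \<Rightarrow> vec3" where
  "angular_velocity I\<^sub>1 I\<^sub>2 z =
     inertia (1/I\<^sub>1) (1/I\<^sub>2) *v (fst (snd z) - cross3 (snd (fst z)) (snd (snd z)))"

text \<open>Since \<open>legendre\<close> is a bijection, exhibiting one preimage of
  \<open>(\<pi>, p)\<close> determines the value of \<open>inv\<close>.\<close>

lemma hamiltonian_eq:
  assumes "I\<^sub>1 \<noteq> 0" "I\<^sub>2 \<noteq> 0"
  shows "hamiltonian (inertia I\<^sub>1 I\<^sub>2) z =
    ((fst (snd z) - cross3 (snd (fst z)) (snd (snd z))) \<bullet> angular_velocity I\<^sub>1 I\<^sub>2 z
      + snd (snd z) \<bullet> snd (snd z)) / 2 + potential (inertia I\<^sub>1 I\<^sub>2) (snd (fst z))"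
proof -
  let ?I = "inertia I\<^sub>1 I\<^sub>2"
  obtain B R \<pi> p where z: "z = ((B, R), (\<pi>, p))" by (metis surj_pair)
  define \<Omega> where "\<Omega> = angular_velocity I\<^sub>1 I\<^sub>2 z"
  have I\<Omega>: "?I *v \<Omega> = \<pi> - cross3 R p"
    using assms by (simp add: \<Omega>_def angular_velocity_def z inertia_inverse)
  have "legendre ?I (B, R) (\<Omega>, p - cross3 \<Omega> R) = (\<pi>, p)"
    by (simp add: legendre_def I\<Omega>)
  then have "inv (legendre ?I (B, R)) (\<pi>, p) = (\<Omega>, p - cross3 \<Omega> R)"
    by (metis bij_legendre[OF invertible_inertia[OF assms]] bij_is_inj inv_f_f)
  then have "hamiltonian ?I z = kinetic ?I (B, R) (\<Omega>, p - cross3 \<Omega> R) + potential ?I R"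
    by (simp add: hamiltonian_def z)
  also have "kinetic ?I (B, R) (\<Omega>, p - cross3 \<Omega> R) = ((\<pi> - cross3 R p) \<bullet> \<Omega> + p \<bullet> p) / 2"
    by (simp add: kinetic_def I\<Omega> power2_norm_eq_inner inner_commute)
  finally show ?thesis by (simp add: z \<Omega>_def)
qed

lemma hamiltonian_has_derivative:
  assumes "I\<^sub>1 \<noteq> 0" "I\<^sub>2 \<noteq> 0" and R: "snd (fst z) \<noteq> 0"
  shows "(hamiltonian (inertia I\<^sub>1 I\<^sub>2) has_derivative
    (\<lambda>h. angular_velocity I\<^sub>1 I\<^sub>2 z \<bullet> (fst (snd h) - cross3 (snd (fst h)) (snd (snd z))
            - cross3 (snd (fst z)) (snd (snd h)))
       + snd (snd z) \<bullet> snd (snd h) + grad_potential (inertia I\<^sub>1 I\<^sub>2) (snd (fst z)) \<bullet> snd (fst h))) (at z)"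
proof -
  let ?J = "inertia (1/I\<^sub>1) (1/I\<^sub>2)"
  let ?L = "\<lambda>z::phase. fst (snd z) - cross3 (snd (fst z)) (snd (snd z))"
  have H: "hamiltonian (inertia I\<^sub>1 I\<^sub>2) = (\<lambda>z. (?L z \<bullet> (?J *v ?L z) + snd (snd z) \<bullet> snd (snd z)) / 2
      + potential (inertia I\<^sub>1 I\<^sub>2) (snd (fst z)))"
    using assms by (simp add: fun_eq_iff hamiltonian_eq angular_velocity_def)
  have V: "((\<lambda>z::phase. potential (inertia I\<^sub>1 I\<^sub>2) (snd (fst z))) has_derivative
      (\<lambda>h. grad_potential (inertia I\<^sub>1 I\<^sub>2) (snd (fst z)) \<bullet> snd (fst h))) (at z)"
  proof -
    have "((\<lambda>z::phase. snd (fst z)) has_derivative (\<lambda>h. snd (fst h))) (at z)"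
      by (auto intro!: derivative_eq_intros)
    then show ?thesis
      by (rule has_derivative_compose) (rule potential_has_derivative[OF R])
  qed
  have L: "(?L has_derivative (\<lambda>h. fst (snd h) - cross3 (snd (fst h)) (snd (snd z))
      - cross3 (snd (fst z)) (snd (snd h)))) (at z)"
    by (auto intro!: derivative_eq_intros simp: algebra_simps)
  have Q: "((\<lambda>z. ?L z \<bullet> (?J *v ?L z)) has_derivative (\<lambda>h. 2 * ((fst (snd h)
      - cross3 (snd (fst h)) (snd (snd z)) - cross3 (snd (fst z)) (snd (snd h))) \<bullet> (?J *v ?L z)))) (at z)"
    using L by (rule has_derivative_compose) (rule inertia_quadratic_has_derivative)
  have K: "((\<lambda>z::phase. snd (snd z) \<bullet> snd (snd z)) has_derivative
      (\<lambda>h. 2 * (snd (snd z) \<bullet> snd (snd h)))) (at z)"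
    by (auto intro!: derivative_eq_intros simp: inner_commute)
  show ?thesis
    unfolding H
    by (rule has_derivative_eq_rhs[OF has_derivative_add[OF
          bounded_linear.has_derivative[OF bounded_linear_divide has_derivative_add[OF Q K]] V]])
       (simp add: fun_eq_iff angular_velocity_def inner_commute)
qed

text \<open>Pairing with fibre directions sees only \<open>fst X\<close>; once these parts agree,
  the term with \<pi> agrees too, and base directions recover \<open>snd X\<close>. This justifies
  the \<open>THE\<close> in \<open>ham_vf\<close>.\<close>

lemma symplectic_form_nondegenerate:
  assumes "\<And>Y. symplectic_form z X Y = symplectic_form z X' Y"
  shows "X = X'"
proof -
  have "fst X \<bullet> v = fst X' \<bullet> v" for v
    using assms[of "(0, v)"] by (simp add: symplectic_form_def)
  then have f: "fst X = fst X'" using vector_eq_rdot by blast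
  have "snd X \<bullet> u = snd X' \<bullet> u" for u
    using assms[of "(u, 0)"] by (simp add: symplectic_form_def f)
  then have "snd X = snd X'" using vector_eq_rdot by blast
  with f show ?thesis by (simp add: prod_eq_iff)
qed

lemma ham_vf_eqI:
  assumes "(F has_derivative F') (at z)" "\<And>Y. symplectic_form z X Y = F' (embed_tangent z Y)"
  shows "ham_vf F z = X"
  unfolding ham_vf_def tangent_derivative_def frechet_derivative_at[OF assms(1), symmetric]
proof (rule the_equality)
  show "X' = X" if "\<forall>Y. symplectic_form z X' Y = F' (embed_tangent z Y)" for X'
    by (rule symplectic_form_nondegenerate[of z]) (simp add: that assms(2))
qed (simp add: assms(2))

text \<open>Here \<pi> is the total angular momentum seen from the body, orbital part included. It
  obeys the Euler equation without a torque term, as gravity only exchanges angular momentum between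
  spin and orbit.\<close>

definition hamilton_field :: "real \<Rightarrow> real \<Rightarrow> phase \<Rightarrow> phase_tvec" where
  "hamilton_field I\<^sub>1 I\<^sub>2 z = (let R = snd (fst z); \<pi> = fst (snd z); p = snd (snd z);
       \<Omega> = angular_velocity I\<^sub>1 I\<^sub>2 z in
     ((\<Omega>, p - cross3 \<Omega> R), (cross3 \<pi> \<Omega>, cross3 p \<Omega> - grad_potential (inertia I\<^sub>1 I\<^sub>2) R)))"

lemma momentum_components: "momentum z = (fst (fst z) *v fst (snd z),
    (cross3 (snd (fst z)) (snd (snd z)) - fst (snd z)) \<bullet> e1)"
  by (metis momentum_eq prod.collapse)

lemma momentum_has_derivative:
  "(momentum has_derivative (\<lambda>h. (fst (fst z) *v fst (snd h) + fst (fst h) *v fst (snd z),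
      (cross3 (snd (fst z)) (snd (snd h)) + cross3 (snd (fst h)) (snd (snd z)) - fst (snd h)) \<bullet> e1))) (at z)"
proof -
  have M: "momentum = (\<lambda>z. (fst (fst z) *v fst (snd z),
    (cross3 (snd (fst z)) (snd (snd z)) - fst (snd z)) \<bullet> e1))"
    by (rule ext) (rule momentum_components)
  show ?thesis
    unfolding M by (auto intro!: derivative_eq_intros)
qed

lemma symplectic_form_hamilton_field:
  assumes "I\<^sub>1 \<noteq> 0" "I\<^sub>2 \<noteq> 0" "snd (fst z) \<noteq> 0"
  shows "symplectic_form z (hamilton_field I\<^sub>1 I\<^sub>2 z) Y =
    frechet_derivative (hamiltonian (inertia I\<^sub>1 I\<^sub>2)) (at z) (embed_tangent z Y)"
proof -
  obtain b dR d\<pi> dp where Y: "Y = ((b, dR), (d\<pi>, dp))" by (metis surj_pair)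
  show ?thesis
    unfolding frechet_derivative_at[OF hamiltonian_has_derivative[OF assms], symmetric] Y
    by (simp add: symplectic_form_def hamilton_field_def embed_tangent_def Let_def)
       (simp add: cross3_simps)
qed

text \<open>The momentum map property: generators are the Hamiltonian vector fields of the
  components of the momentum. The matrix \<open>transpose B\<close> enters only as the adjoint of
  \<open>B\<close>, so the identity holds at every point of the ambient space, where the field is
  later differentiated.\<close>

lemma symplectic_form_phase_generator:
  "symplectic_form z (phase_generator \<zeta> z) Y =
    frechet_derivative (\<lambda>z. momentum z \<bullet> \<zeta>) (at z) (embed_tangent z Y)"
proof -
  obtain B R \<pi> p where z: "z = ((B, R), (\<pi>, p))" by (metis surj_pair)
  obtain \<xi> \<eta> where \<zeta>: "\<zeta> = (\<xi>, \<eta>)" by (metis surj_pair)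
  obtain b dR d\<pi> dp where Y: "Y = ((b, dR), (d\<pi>, dp))" by (metis surj_pair)
  have D: "((\<lambda>z. momentum z \<bullet> \<zeta>) has_derivative (\<lambda>h. (B *v fst (snd h) + fst (fst h) *v \<pi>,
      (cross3 R (snd (snd h)) + cross3 (snd (fst h)) p - fst (snd h)) \<bullet> e1) \<bullet> \<zeta>)) (at z)"
    using momentum_has_derivative[of z] by (auto intro!: derivative_eq_intros simp: z)
  have "(transpose B *v \<xi>) \<bullet> w = (B *v w) \<bullet> \<xi>" for w
    by (metis dot_lmul_matrix inner_commute transpose_matrix_vector)
  moreover have "(B ** hat b) *v \<pi> = B *v cross3 b \<pi>"
    by (simp add: matrix_vector_mul_assoc[symmetric] hat_vec)
  moreover have "\<pi> \<bullet> cross3 w b = w \<bullet> cross3 b \<pi>" for w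
    by (simp add: cross3_simps)
  ultimately have *: "(transpose B *v \<xi>) \<bullet> d\<pi> + \<pi> \<bullet> cross3 (transpose B *v \<xi>) b
      = (B *v d\<pi> + (B ** hat b) *v \<pi>) \<bullet> \<xi>"
    by (simp add: inner_add_left)
  show ?thesis
    unfolding frechet_derivative_at[OF D, symmetric]
    by (simp add: symplectic_form_def phase_generator_def config_generator_def z \<zeta> Y embed_tangent_def
        *[symmetric])
       (simp add: cross3_simps)
qed

lemma ham_vf_hamiltonian:
  assumes "I\<^sub>1 \<noteq> 0" "I\<^sub>2 \<noteq> 0" "snd (fst z) \<noteq> 0"
  shows "ham_vf (hamiltonian (inertia I\<^sub>1 I\<^sub>2)) z = hamilton_field I\<^sub>1 I\<^sub>2 z"
  using hamiltonian_has_derivative[OF assms] symplectic_form_hamilton_field[OF assms]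
  by (intro ham_vf_eqI) (auto simp: frechet_derivative_works[symmetric] differentiable_def)

lemma symplectic_form_diff: "symplectic_form z (X - X') Y = symplectic_form z X Y - symplectic_form z X' Y"
  by (simp add: symplectic_form_def inner_diff_left inner_diff_right Cross3.left_diff_distrib)

lemma ham_vf_augmented:
  assumes "I\<^sub>1 \<noteq> 0" "I\<^sub>2 \<noteq> 0" "snd (fst z) \<noteq> 0"
  shows "ham_vf (\<lambda>z. hamiltonian (inertia I\<^sub>1 I\<^sub>2) z - momentum z \<bullet> \<zeta>) z
    = hamilton_field I\<^sub>1 I\<^sub>2 z - phase_generator \<zeta> z"
proof (rule ham_vf_eqI)
  have "(\<lambda>z. momentum z \<bullet> \<zeta>) differentiable at z"
    using momentum_has_derivative[of z]
    by (intro differentiable_inner differentiable_const) (auto simp: differentiable_def)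
  then show "((\<lambda>z. hamiltonian (inertia I\<^sub>1 I\<^sub>2) z - momentum z \<bullet> \<zeta>) has_derivative
      (\<lambda>h. frechet_derivative (hamiltonian (inertia I\<^sub>1 I\<^sub>2)) (at z) h
          - frechet_derivative (\<lambda>z. momentum z \<bullet> \<zeta>) (at z) h)) (at z)"
    using hamiltonian_has_derivative[OF assms]
    by (intro has_derivative_diff) (auto simp: frechet_derivative_works[symmetric] differentiable_def)
qed (simp add: symplectic_form_diff symplectic_form_hamilton_field[OF assms]
    symplectic_form_phase_generator)

subsection \<open>Instability of oblate bodies\<close>

lemma angular_velocity_has_derivative:
  "(angular_velocity I\<^sub>1 I\<^sub>2 has_derivative (\<lambda>h. inertia (1/I\<^sub>1) (1/I\<^sub>2) *v
     (fst (snd h) - cross3 (snd (fst h)) (snd (snd z)) - cross3 (snd (fst z)) (snd (snd h))))) (at z)"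
proof -
  have A: "angular_velocity I\<^sub>1 I\<^sub>2 = (\<lambda>z. inertia (1/I\<^sub>1) (1/I\<^sub>2) *v
      (fst (snd z) - cross3 (snd (fst z)) (snd (snd z))))"
    by (rule ext) (simp add: angular_velocity_def)
  show ?thesis
    unfolding A by (auto intro!: derivative_eq_intros simp: algebra_simps)
qed

lemma augmented_linearization_eq:
  fixes B :: mat3 and R \<pi> p b dR d\<pi> dp \<xi> :: vec3
  assumes "I\<^sub>1 \<noteq> 0" "I\<^sub>2 \<noteq> 0" "R \<noteq> 0"
  defines "\<Omega> \<equiv> angular_velocity I\<^sub>1 I\<^sub>2 ((B, R), (\<pi>, p))"
    and "d\<Omega> \<equiv> inertia (1/I\<^sub>1) (1/I\<^sub>2) *v (d\<pi> - cross3 dR p - cross3 R dp)"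
  shows "augmented_linearization (inertia I\<^sub>1 I\<^sub>2) ((B, R), (\<pi>, p)) (\<xi>, \<eta>) ((b, dR), (d\<pi>, dp)) =
    ((d\<Omega> - transpose (B ** hat b) *v \<xi>, dp - cross3 d\<Omega> R - cross3 \<Omega> dR - \<eta> *\<^sub>R cross3 e1 dR),
     (cross3 d\<pi> \<Omega> + cross3 \<pi> d\<Omega> - \<eta> *\<^sub>R cross3 e1 d\<pi>,
      cross3 dp \<Omega> + cross3 p d\<Omega> - hess_potential (inertia I\<^sub>1 I\<^sub>2) R dR - \<eta> *\<^sub>R cross3 e1 dp))"
proof -
  let ?I = "inertia I\<^sub>1 I\<^sub>2" and ?z = "((B, R), (\<pi>, p))"
  \<comment> \<open>\<open>ham_vf_augmented\<close> is available for nonzero position, so the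
    derivative of the explicit field is carried over to \<open>ham_vf\<close> on this open
    set.\<close>
  define S :: "phase set" where "S = {z. snd (fst z) \<noteq> 0}"
  have "open (UNIV \<times> - {0} :: config set)" by (intro open_Times) auto
  then have "open ((UNIV \<times> - {0}) \<times> UNIV :: phase set)" by (intro open_Times) auto
  moreover have "(UNIV \<times> - {0}) \<times> UNIV = S" by (auto simp: S_def)
  ultimately have S: "open S" by simp
  let ?d\<Omega> = "\<lambda>h::phase. inertia (1/I\<^sub>1) (1/I\<^sub>2) *v
     (fst (snd h) - cross3 (snd (fst h)) p - cross3 R (snd (snd h)))"
  let ?X = "\<lambda>z. hamilton_field I\<^sub>1 I\<^sub>2 z - phase_generator (\<xi>, \<eta>) z"
  have w: "(angular_velocity I\<^sub>1 I\<^sub>2 has_derivative ?d\<Omega>) (at ?z)"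
    using angular_velocity_has_derivative[of I\<^sub>1 I\<^sub>2 ?z] by simp
  have g: "((\<lambda>z::phase. grad_potential ?I (snd (fst z))) has_derivative
      (\<lambda>h. hess_potential ?I R (snd (fst h)))) (at ?z)"
  proof -
    have "((\<lambda>z::phase. snd (fst z)) has_derivative (\<lambda>h. snd (fst h))) (at ?z)"
      by (auto intro!: derivative_eq_intros)
    moreover have "(grad_potential ?I has_derivative hess_potential ?I R) (at (snd (fst ?z)))"
      using grad_potential_has_derivative[OF assms(3)] by simp
    ultimately show ?thesis
      by (rule has_derivative_compose)
  qed
  have X: "?X = (\<lambda>z. ((angular_velocity I\<^sub>1 I\<^sub>2 z - (transpose (fst (fst z)) *v \<xi> - \<eta> *\<^sub>R e1),
       snd (snd z) - cross3 (angular_velocity I\<^sub>1 I\<^sub>2 z) (snd (fst z)) - \<eta> *\<^sub>R cross3 e1 (snd (fst z))),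
      (cross3 (fst (snd z)) (angular_velocity I\<^sub>1 I\<^sub>2 z) - \<eta> *\<^sub>R cross3 e1 (fst (snd z)),
       cross3 (snd (snd z)) (angular_velocity I\<^sub>1 I\<^sub>2 z) - grad_potential ?I (snd (fst z))
         - \<eta> *\<^sub>R cross3 e1 (snd (snd z)))))"
    by (simp add: fun_eq_iff hamilton_field_def phase_generator_def config_generator_def Let_def)
  have D: "(?X has_derivative
    (\<lambda>h. ((?d\<Omega> h - transpose (fst (fst h)) *v \<xi>,
       snd (snd h) - cross3 (?d\<Omega> h) R - cross3 \<Omega> (snd (fst h)) - \<eta> *\<^sub>R cross3 e1 (snd (fst h))),
      (cross3 (fst (snd h)) \<Omega> + cross3 \<pi> (?d\<Omega> h) - \<eta> *\<^sub>R cross3 e1 (fst (snd h)),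
       cross3 (snd (snd h)) \<Omega> + cross3 p (?d\<Omega> h) - hess_potential ?I R (snd (fst h))
         - \<eta> *\<^sub>R cross3 e1 (snd (snd h)))))) (at ?z)"
    unfolding X
    by (rule derivative_eq_intros w g refl)+ (simp add: fun_eq_iff \<Omega>_def)
  have "(ham_vf (\<lambda>z. hamiltonian ?I z - momentum z \<bullet> (\<xi>, \<eta>)) has_derivative
    (\<lambda>h. ((?d\<Omega> h - transpose (fst (fst h)) *v \<xi>,
       snd (snd h) - cross3 (?d\<Omega> h) R - cross3 \<Omega> (snd (fst h)) - \<eta> *\<^sub>R cross3 e1 (snd (fst h))),
      (cross3 (fst (snd h)) \<Omega> + cross3 \<pi> (?d\<Omega> h) - \<eta> *\<^sub>R cross3 e1 (fst (snd h)),
       cross3 (snd (snd h)) \<Omega> + cross3 p (?d\<Omega> h) - hess_potential ?I R (snd (fst h))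
         - \<eta> *\<^sub>R cross3 e1 (snd (snd h)))))) (at ?z)"
    by (rule has_derivative_transform_within_open[OF D S])
       (use assms(3) in \<open>auto simp: S_def ham_vf_augmented[OF assms(1,2)]\<close>)
  then show ?thesis
    unfolding augmented_linearization_def tangent_derivative_def
    by (simp add: frechet_derivative_at[symmetric] embed_tangent_def d\<Omega>_def)
qed

section \<open>From a real eigenvector to instability\<close>

lemma mat_1_in_SO3: "mat 1 \<in> SO3"
  by (simp add: SO3_def rotation_matrix_def orthogonal_matrix_def transpose_mat)

lemma block_in_Gamma_axi: "orthogonal_matrix O2 \<Longrightarrow> block 1 O2 \<in> Gamma_axi"
  unfolding Gamma_axi_def by blast

lemma block_mat_1: "block 1 (mat 1) = mat 1"
  by (simp add: block_def vec_eq_iff forall_3 mat_def)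

lemma zero_in_stabilizer_alg: "0 \<in> stabilizer_alg \<mu>"
proof -
  have "orthogonal_matrix (mat 1 :: real^2^2)"
    by (simp add: orthogonal_matrix_def transpose_mat)
  then have "mat 1 \<in> Gamma_axi"
    using block_in_Gamma_axi[of "mat 1"] by (simp add: block_mat_1)
  moreover have "chi (mat 1) = 1" by (simp add: chi_def mat_def)
  ultimately have "(mat 1, mat 1) \<in> stabilizer \<mu>"
    by (simp add: stabilizer_def G_axi_def mat_1_in_SO3 coadjoint_def)
  moreover have "hat 0 = 0" by (simp add: hat_eq vec_eq_iff forall_3)
  ultimately show ?thesis
    by (simp add: stabilizer_alg_def one_param_def mexp_0)
qed

lemma embed_tangent_zero: "embed_tangent z 0 = 0"
  by (simp add: embed_tangent_def linear_0[OF bounded_linear.linear[OF bounded_linear_hat]]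
      linear_0[OF linear_mult_left] zero_prod_def)

lemma phase_generator_zero: "phase_generator 0 z = 0"
  by (simp add: phase_generator_def config_generator_def zero_prod_def split: prod.splits)

text \<open>For a real eigenvalue the eigenvector can be taken real, so the imaginary part of the
  complexified one is 0. Excluding the generators of the whole Lie algebra spares the computation of
  \<open>stabilizer_alg\<close>.\<close>

lemma unstableI:
  assumes "l > 0" "tangent_derivative momentum p u = 0"
    and "augmented_linearization I p \<zeta> u = l *\<^sub>R u" "augmented_linearization I p \<zeta> 0 = 0"
    and "\<And>\<zeta>'. u \<noteq> phase_generator \<zeta>' p"
  shows "unstable I p \<zeta>"
proof -
  let ?W = "(\<lambda>\<zeta>'. phase_generator \<zeta>' p) ` stabilizer_alg (momentum p)"
  have W: "0 \<in> ?W"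
    using zero_in_stabilizer_alg phase_generator_zero by (metis image_iff)
  have "tangent_derivative momentum p 0 = 0"
    using linear_0[OF has_derivative_linear[OF momentum_has_derivative[of p]]]
    unfolding tangent_derivative_def embed_tangent_zero
      frechet_derivative_at[OF momentum_has_derivative, symmetric] .
  then have "quotient_eigenvalue (augmented_linearization I p \<zeta>)
      {X. tangent_derivative momentum p X = 0} ?W (complex_of_real l)"
    unfolding quotient_eigenvalue_def
    using assms W by (intro bexI[of _ u] bexI[of _ 0]) auto
  then show ?thesis
    unfolding unstable_def using assms(1) by (metis Re_complex_of_real)
qed

text \<open>The product \<open>c\<close> of the roots is negative, so they are real with opposite
  signs; the larger one is taken.\<close>

lemma quadratic_positive_root:
  fixes b c :: real
  assumes "c < 0"
  obtains s where "s > 0" "s\<^sup>2 + b * s + c = 0"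
proof
  let ?d = "b\<^sup>2 - 4 * c"
  have "\<bar>b\<bar> < sqrt ?d" using assms by (intro real_less_rsqrt) simp
  then show "(- b + sqrt ?d) / 2 > 0" by simp
  have "(sqrt ?d)\<^sup>2 = ?d"
    using assms zero_le_power2[of b] by (intro real_sqrt_pow2) linarith
  then show "((- b + sqrt ?d) / 2)\<^sup>2 + b * ((- b + sqrt ?d) / 2) + c = 0"
    by (simp add: power2_eq_square field_simps)
qed

text \<open>The linearised motion in the orbital plane: \<open>(x, y)\<close> and \<open>(a, c)\<close> are the variations of position
  and linear momentum, \<open>m\<close> that of the angular velocity and \<open>j\<close> the transverse moment of inertia, while
  \<open>v\<close> and \<open>w\<^sup>2 - k\<close> are the radial and tangential second derivatives of the potential.  Under the
  hypotheses the characteristic polynomial, quadratic in \<open>l\<^sup>2\<close>, is negative at \<open>0\<close>.\<close>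

lemma planar_eigenvector:
  fixes w R j v k :: real
  assumes pos: "k > 0" "j > 0" "R > 0" and w: "w \<noteq> 0"
    and large: "v * (j + R\<^sup>2) + w\<^sup>2 * (3 * R\<^sup>2 - j) > 0"
  obtains l x y a c m where "l > 0" "y \<noteq> 0" "m = R * (c - w * x) / j"
    "l * x = a - w * y" "l * y = c + m * R + w * x"
    "l * a = w * R * m - c * w - v * x" "l * c = a * w - (w\<^sup>2 - k) * y"
proof -
  \<comment> \<open>Elimination behind \<open>n\<close> and \<open>q\<close>: the equations for
    \<open>l * x\<close> and \<open>l * c\<close> give \<open>l * (c - w * x) = k * y\<close>. With
    \<open>s = l\<^sup>2\<close>, the one for \<open>l * y\<close> becomes
    \<open>(s - n) * y = 2 * w * l * x\<close>, and then the one for \<open>l * a\<close> becomes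
    the quadratic for \<open>s\<close> below, with constant term \<open>q\<close>.\<close>
  define n where "n = k * (j + R\<^sup>2) / j"
  have nj: "n * j = k * (j + R\<^sup>2)" using pos by (simp add: n_def)
  define q where "q = - (n * (w\<^sup>2 + v)) - 2 * w\<^sup>2 * k * (R\<^sup>2 - j) / j"
  have "q = - (k / j) * (v * (j + R\<^sup>2) + w\<^sup>2 * (3 * R\<^sup>2 - j))"
    using pos by (simp add: q_def n_def field_simps)
  then have "q < 0" using large pos by (simp add: mult_neg_pos)
  then obtain s where s: "s > 0" "s\<^sup>2 + (w\<^sup>2 + v - n + 2 * w\<^sup>2) * s + q = 0"
    using quadratic_positive_root by blast
  define l where "l = sqrt s"
  have l: "l > 0" "l * l = s" using s by (auto simp: l_def)
  \<comment> \<open>This scaling solves \<open>(s - n) * y = 2 * w * l * x\<close> without division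
    and keeps \<open>y\<close> nonzero even if \<open>s = n\<close>.\<close>
  define x where "x = s - n"
  define y where "y = 2 * w * l"
  define m where "m = 2 * k * R * w / j"
  define c where "c = w * x + j * m / R"
  define a where "a = l * x + w * y"
  have jm: "j * m = 2 * k * R * w" using pos by (simp add: m_def)
  have c': "c = w * x + 2 * k * w" using jm pos by (simp add: c_def)
  show ?thesis
  proof
    show "y \<noteq> 0" using w l by (simp add: y_def)
    show "m = R * (c - w * x) / j" using pos by (simp add: c_def m_def)
    show "l * y = c + m * R + w * x"
    proof -
      have "j * (l * y) = j * (c + m * R + w * x)"
      proof -
        have "j * (c + m * R + w * x) = 2 * w * (j * x) + 2 * k * w * j + (j * m) * R"
          by (simp add: c' algebra_simps)
        also have "\<dots> = 2 * w * (j * s) - 2 * w * (n * j) + 2 * w * (k * (j + R\<^sup>2))"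
          unfolding jm x_def by (simp add: algebra_simps power2_eq_square)
        also have "\<dots> = j * (l * y)"
          unfolding nj by (simp add: y_def l(2)[symmetric] mult_ac)
        finally show ?thesis by (rule sym)
      qed
      then show ?thesis using pos by simp
    qed
    show "l * a = w * R * m - c * w - v * x"
    proof -
      have "(s + w\<^sup>2 + v) * x + 2 * w\<^sup>2 * s = 2 * w\<^sup>2 * k * (R\<^sup>2 - j) / j"
        using s(2) by (simp add: x_def q_def algebra_simps power2_eq_square)
      also have "\<dots> = w * R * m - 2 * k * w\<^sup>2"
        using pos by (simp add: m_def field_simps power2_eq_square)
      finally have "s * x + 2 * w\<^sup>2 * s = w * R * m - c * w - v * x"
        by (simp add: c' algebra_simps power2_eq_square)
      moreover have "l * a = (l * l) * x + 2 * w\<^sup>2 * (l * l)"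
        by (simp add: a_def y_def algebra_simps power2_eq_square)
      ultimately show ?thesis by (simp add: l(2))
    qed
    show "l * c = a * w - (w\<^sup>2 - k) * y"
      by (simp add: c' a_def y_def algebra_simps power2_eq_square)
  qed (use l in \<open>simp_all add: a_def\<close>)
qed


text \<open>The rotation is about a transverse body axis, so only the transverse inertia
  \<open>j\<close> enters: \<open>j + R\<^sup>2\<close> is the total moment of inertia, and the
  linear momentum is the cross product of angular velocity and position.\<close>

definition rel_eq :: "real \<Rightarrow> real \<Rightarrow> real \<Rightarrow> phase" where
  "rel_eq j R w = ((mat 1, vector [R, 0, 0]), (vector [0, (j + R\<^sup>2) * w, 0], vector [0, 0, - (R * w)]))"

lemma phase_point_rel_eq:
  "phase_point (inertia I\<^sub>1 I\<^sub>2) (mat 1, vector [R, 0, 0]) (vector [0, w, 0], 0) = rel_eq I\<^sub>2 R w"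
  by (simp add: phase_point_def rel_eq_def config_generator_def legendre_def transpose_mat inertia_mult)
     (simp add: vec_eq_iff forall_3 cross3_def power2_eq_square algebra_simps)

lemma norm_vector_1: "norm (vector [R, 0, 0] :: vec3) = \<bar>R\<bar>"
  by (simp add: norm_eq_sqrt_inner inner_vec_def sum_3)

lemma rel_eq_unstable:
  fixes I\<^sub>1 I\<^sub>2 R w :: real
  assumes I: "0 < I\<^sub>1" "0 < I\<^sub>2" "I\<^sub>1 + 2 * I\<^sub>2 = 1" and R: "0 < R"
    and w: "w\<^sup>2 = (2 * R\<^sup>2 + 3 - 9 * I\<^sub>1) / (2 * R ^ 5)" "w \<noteq> 0"
    and large: "R ^ 4 > 3 * R\<^sup>2 * (2 * I\<^sub>2 - I\<^sub>1) + 15 * I\<^sub>2 * (I\<^sub>2 - I\<^sub>1)"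
    and oblate: "I\<^sub>2 < I\<^sub>1"
  shows "unstable (inertia I\<^sub>1 I\<^sub>2) (rel_eq I\<^sub>2 R w) (vector [0, w, 0], 0)"
proof -
  \<comment> \<open>In the tangential second derivative of the potential, the radial force divided
    by \<open>R\<close> contributes \<open>w\<^sup>2\<close>, and the energy of tilting the position
    against the symmetry axis contributes \<open>- k\<close>.\<close>
  define k where "k = 3 * (I\<^sub>1 - I\<^sub>2) / R ^ 5"
  define v where "v = - 2 / R ^ 3 - 12 * (I\<^sub>2 - I\<^sub>1) / R ^ 5"
  \<comment> \<open>The left side is \<open>I\<^sub>2 + R\<^sup>2\<close> times the second
    derivative of the amended potential, which links the large orbit condition to
    \<open>planar_eigenvector\<close>.\<close>
  have "v * (I\<^sub>2 + R\<^sup>2) + w\<^sup>2 * (3 * R\<^sup>2 - I\<^sub>2)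
    = (R ^ 4 - 3 * R\<^sup>2 * (2 * I\<^sub>2 - I\<^sub>1) - 15 * I\<^sub>2 * (I\<^sub>2 - I\<^sub>1)) / R ^ 5"
  proof -
    have I1: "I\<^sub>1 = 1 - 2 * I\<^sub>2" using I by simp
    show ?thesis
      using R unfolding v_def w(1) I1 by (simp add: field_simps eval_nat_numeral)
  qed
  then have large': "v * (I\<^sub>2 + R\<^sup>2) + w\<^sup>2 * (3 * R\<^sup>2 - I\<^sub>2) > 0"
    using large R by simp
  have k: "k > 0" using oblate R by (simp add: k_def)
  obtain l x y a c m where l: "l > 0" and y: "y \<noteq> 0" and m: "m = R * (c - w * x) / I\<^sub>2"
    and eqs: "l * x = a - w * y" "l * y = c + m * R + w * x"
      "l * a = w * R * m - c * w - v * x" "l * c = a * w - (w\<^sup>2 - k) * y"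
    using planar_eigenvector[OF k I(2) R w(2) large'] by metis
  \<comment> \<open>The attitude turns about the direction of \<pi>, which does not vary, so the
    spatial momentum is fixed; position and linear momentum vary in the orbital plane, so the axial
    component is fixed too. The attitude rate \<open>m / l\<close> is forced by the eigenvalue
    equation, where the term with \<open>hat\<close> vanishes for parallel vectors.\<close>
  define u :: phase_tvec where
    "u = ((vector [0, m / l, 0], vector [x, 0, y]), (0, vector [a, 0, c]))"
  let ?I = "inertia I\<^sub>1 I\<^sub>2" and ?R = "vector [R, 0, 0] :: vec3"
  have R0: "?R \<noteq> 0" using R by (simp add: vec_eq_iff forall_3)
  have I0: "I\<^sub>1 \<noteq> 0" "I\<^sub>2 \<noteq> 0" using I by auto
  have av: "angular_velocity I\<^sub>1 I\<^sub>2 (rel_eq I\<^sub>2 R w) = vector [0, w, 0]"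
    using I by (simp add: angular_velocity_def rel_eq_def inertia_mult vec_eq_iff forall_3 cross3_def
        field_simps power2_eq_square)
  have hess: "hess_potential ?I ?R (vector [x, 0, y]) = vector [v * x, 0, (w\<^sup>2 - k) * y]"
  proof -
    have I1: "I\<^sub>1 = 1 - 2 * I\<^sub>2" using I by simp
    have "R \<noteq> 0" using R by simp
    then show ?thesis
      unfolding hess_potential_def norm_vector_1 inertia_inner inertia_mult v_def w(1) k_def I1
      using R by (simp add: vec_eq_iff forall_3 inner_vec_def sum_3)
         (simp add: field_simps eval_nat_numeral)
  qed
  have dm: "inertia (1/I\<^sub>1) (1/I\<^sub>2) *v (0 - cross3 (vector [x, 0, y]) (vector [0, 0, - (R * w)])
      - cross3 ?R (vector [a, 0, c])) = vector [0, m, 0]"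
    using I by (simp add: inertia_mult vec_eq_iff forall_3 cross3_def m field_simps)
  show ?thesis
  proof (rule unstableI[OF l])
    show "tangent_derivative momentum (rel_eq I\<^sub>2 R w) u = 0"
      unfolding tangent_derivative_def frechet_derivative_at[OF momentum_has_derivative, symmetric]
      by (simp add: rel_eq_def u_def embed_tangent_def zero_prod_def hat_vec e1_def inner_axis)
         (simp add: cross3_def vec_eq_iff forall_3)
    have "augmented_linearization ?I (rel_eq I\<^sub>2 R w) (vector [0, w, 0], 0) u =
     ((vector [0, m, 0] - transpose (mat 1 ** hat (vector [0, m / l, 0])) *v vector [0, w, 0],
       vector [a, 0, c] - cross3 (vector [0, m, 0]) ?R - cross3 (vector [0, w, 0]) (vector [x, 0, y])),
     (cross3 (vector [0, (I\<^sub>2 + R\<^sup>2) * w, 0]) (vector [0, m, 0]),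
      cross3 (vector [a, 0, c]) (vector [0, w, 0]) + cross3 (vector [0, 0, - (R * w)]) (vector [0, m, 0])
      - vector [v * x, 0, (w\<^sup>2 - k) * y]))"
      unfolding rel_eq_def u_def
      by (subst augmented_linearization_eq[OF I0 R0])
         (simp add: dm[simplified] av[unfolded rel_eq_def] hess)
    also have "\<dots> = l *\<^sub>R u"
      using l eqs by (simp add: u_def hat_eq matrix_vector_mult_def transpose_def sum_3)
        (simp add: vec_eq_iff forall_3 cross3_def algebra_simps)
    finally show "augmented_linearization ?I (rel_eq I\<^sub>2 R w) (vector [0, w, 0], 0) u = l *\<^sub>R u" .
    show "augmented_linearization ?I (rel_eq I\<^sub>2 R w) (vector [0, w, 0], 0) 0 = 0"
      unfolding rel_eq_def zero_prod_def
      by (subst augmented_linearization_eq[OF I0 R0])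
         (simp add: hess_potential_def linear_0[OF bounded_linear.linear[OF bounded_linear_hat]]
           linear_0[OF linear_mult_left] linear_0[OF bounded_linear.linear[OF bounded_linear_transpose]])
    \<comment> \<open>An infinitesimal symmetry moves the position by a multiple of e1 x R, which is
      0 here, while \<open>u\<close> moves it by \<open>y\<close> in the third direction.\<close>
    show "u \<noteq> phase_generator \<zeta>' (rel_eq I\<^sub>2 R w)" for \<zeta>'
    proof
      assume "u = phase_generator \<zeta>' (rel_eq I\<^sub>2 R w)"
      then have "vector [x, 0, y] = snd \<zeta>' *\<^sub>R cross3 e1 ?R"
        by (simp add: u_def phase_generator_def config_generator_def rel_eq_def split: prod.splits)
      then show False
        using y by (simp add: vec_eq_iff forall_3 cross3_def e1_def axis_def)
    qed
  qed
qed

subsection \<open>Lipschitz continuity of the Hamiltonian vector field\<close>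

text \<open>Lipschitz functions alone are not closed under products. Carrying boundedness along
  gives a class stable under all bounded bilinear operations, from which the vector field is
  assembled.\<close>

definition bounded_lipschitz_on :: "'a::real_normed_vector set \<Rightarrow> ('a \<Rightarrow> 'b::real_normed_vector) \<Rightarrow> bool" where
  "bounded_lipschitz_on D f \<longleftrightarrow> bounded (f ` D) \<and> (\<exists>L. L-lipschitz_on D f)"

lemma bounded_lipschitz_on_const: "bounded_lipschitz_on D (\<lambda>_. c)"
proof -
  have "bounded ((\<lambda>_. c) ` D)" by (rule bounded_subset[of "{c}"]) auto
  then show ?thesis unfolding bounded_lipschitz_on_def by (blast intro: lipschitz_on_constant)
qed

lemma bounded_lipschitz_on_linear:
  assumes f: "bounded_linear f" and D: "bounded D"
  shows "bounded_lipschitz_on D f"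
  using bounded_linear_image[OF D f] bounded_linear.lipschitz_boundE[OF f]
  unfolding bounded_lipschitz_on_def by metis

lemma bounded_lipschitz_on_bilinear:
  assumes p: "bounded_bilinear mul" and f: "bounded_lipschitz_on D f" and g: "bounded_lipschitz_on D g"
  shows "bounded_lipschitz_on D (\<lambda>x. mul (f x) (g x))"
proof -
  obtain K where K: "K > 0" "\<And>a b. norm (mul a b) \<le> norm a * norm b * K"
    using bounded_bilinear.pos_bounded[OF p] by blast
  obtain M where M: "M > 0" "\<And>x. x \<in> D \<Longrightarrow> norm (f x) \<le> M"
    using f unfolding bounded_lipschitz_on_def bounded_pos by auto
  obtain N where N: "N > 0" "\<And>x. x \<in> D \<Longrightarrow> norm (g x) \<le> N"
    using g unfolding bounded_lipschitz_on_def bounded_pos by auto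
  obtain A B where A: "A-lipschitz_on D f" and B: "B-lipschitz_on D g"
    using f g unfolding bounded_lipschitz_on_def by blast
  have nn: "0 \<le> A" "0 \<le> B" using A B by (auto intro: lipschitz_on_nonneg)
  have "bounded ((\<lambda>x. mul (f x) (g x)) ` D)"
  proof (rule boundedI)
    fix y assume "y \<in> (\<lambda>x. mul (f x) (g x)) ` D"
    then obtain x where x: "x \<in> D" "y = mul (f x) (g x)" by blast
    have "norm (f x) * norm (g x) \<le> M * N"
      using M N x(1) by (intro mult_mono) (auto intro: less_imp_le)
    then have "norm (f x) * norm (g x) * K \<le> M * N * K" using K(1) by simp
    then show "norm y \<le> M * N * K" using K(2)[of "f x" "g x"] x(2) by simp
  qed
  moreover have "((A * N + M * B) * K)-lipschitz_on D (\<lambda>x. mul (f x) (g x))"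
  proof (rule lipschitz_onI)
    show "0 \<le> (A * N + M * B) * K" using nn M(1) N(1) K(1) by simp
    fix x y assume x: "x \<in> D" and y: "y \<in> D"
    have "mul (f x) (g x) - mul (f y) (g y) = mul (f x - f y) (g x) + mul (f y) (g x - g y)"
      by (simp add: bounded_bilinear.diff_left[OF p] bounded_bilinear.diff_right[OF p])
    then have "dist (mul (f x) (g x)) (mul (f y) (g y))
        \<le> norm (f x - f y) * norm (g x) * K + norm (f y) * norm (g x - g y) * K"
      unfolding dist_norm by (metis K(2) add_mono norm_triangle_le)
    also have "\<dots> \<le> (A * dist x y) * N * K + M * (B * dist x y) * K"
      using K(1) M N x y nn lipschitz_on_normD[OF A x y] lipschitz_on_normD[OF B x y]
      by (intro add_mono mult_right_mono mult_mono)
         (auto intro: less_imp_le simp: dist_norm)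
    finally show "dist (mul (f x) (g x)) (mul (f y) (g y)) \<le> (A * N + M * B) * K * dist x y"
      by (simp add: algebra_simps)
  qed
  ultimately show ?thesis unfolding bounded_lipschitz_on_def by blast
qed

lemma bounded_lipschitz_on_compose_linear:
  assumes h: "bounded_linear h" and f: "bounded_lipschitz_on D f"
  shows "bounded_lipschitz_on D (\<lambda>x. h (f x))"
proof -
  obtain A where A: "A-lipschitz_on D f" using f unfolding bounded_lipschitz_on_def by blast
  obtain B where B: "B-lipschitz_on (f ` D) h" using bounded_linear.lipschitz_boundE[OF h] .
  have "bounded ((\<lambda>x. h (f x)) ` D)"
    using bounded_linear_image[OF _ h, of "f ` D"] f by (simp add: bounded_lipschitz_on_def image_image)
  then show ?thesis
    using lipschitz_on_compose2[OF A B] unfolding bounded_lipschitz_on_def by blast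
qed

lemma bounded_lipschitz_on_Pair:
  assumes f: "bounded_lipschitz_on D f" and g: "bounded_lipschitz_on D g"
  shows "bounded_lipschitz_on D (\<lambda>x. (f x, g x))"
proof -
  have "bounded (f ` D \<times> g ` D)"
    using f g by (auto simp: bounded_lipschitz_on_def intro: bounded_Times)
  then have "bounded ((\<lambda>x. (f x, g x)) ` D)" by (rule bounded_subset) auto
  then show ?thesis
    using f g unfolding bounded_lipschitz_on_def by (blast intro: lipschitz_on_Pair)
qed

lemma bounded_lipschitz_on_add:
  assumes f: "bounded_lipschitz_on D f" and g: "bounded_lipschitz_on D g"
  shows "bounded_lipschitz_on D (\<lambda>x. f x + g x)"
  using bounded_lipschitz_on_compose_linear[OF bounded_linear_add[OF bounded_linear_fst bounded_linear_snd]
      bounded_lipschitz_on_Pair[OF f g]] by simp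

lemma bounded_lipschitz_on_diff:
  assumes f: "bounded_lipschitz_on D f" and g: "bounded_lipschitz_on D g"
  shows "bounded_lipschitz_on D (\<lambda>x. f x - g x)"
  using bounded_lipschitz_on_compose_linear[OF bounded_linear_sub[OF bounded_linear_fst bounded_linear_snd]
      bounded_lipschitz_on_Pair[OF f g]] by simp

lemma bounded_lipschitz_on_inverse_norm:
  assumes f: "bounded_lipschitz_on D f" and r: "r > 0" "\<And>x. x \<in> D \<Longrightarrow> r \<le> norm (f x)"
  shows "bounded_lipschitz_on D (\<lambda>x. 1 / norm (f x))"
proof -
  obtain A where A: "A-lipschitz_on D f"
    using f unfolding bounded_lipschitz_on_def by blast
  have "bounded ((\<lambda>x. 1 / norm (f x)) ` D)"
    by (rule boundedI[of _ "1 / r"]) (use r in \<open>auto intro!: frac_le\<close>)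
  moreover have "(A / (r * r))-lipschitz_on D (\<lambda>x. 1 / norm (f x))"
  proof (rule lipschitz_onI)
    show "0 \<le> A / (r * r)" using lipschitz_on_nonneg[OF A] r by simp
    fix x y assume x: "x \<in> D" and y: "y \<in> D"
    have pos: "norm (f x) > 0" "norm (f y) > 0" using r x y by (meson less_le_trans)+
    have "dist (1 / norm (f x)) (1 / norm (f y)) = \<bar>norm (f x) - norm (f y)\<bar> / (norm (f x) * norm (f y))"
      using pos by (simp add: dist_real_def field_simps abs_minus_commute)
    also have "\<dots> \<le> (A * dist x y) / (r * r)"
    proof (rule frac_le)
      show "\<bar>norm (f x) - norm (f y)\<bar> \<le> A * dist x y"
        using norm_triangle_ineq3[of "f x" "f y"] lipschitz_onD[OF A x y] by (simp add: dist_norm)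
      show "r * r \<le> norm (f x) * norm (f y)"
        using r x y by (intro mult_mono) auto
    qed (use r lipschitz_on_nonneg[OF A] in auto)
    finally show "dist (1 / norm (f x)) (1 / norm (f y)) \<le> A / (r * r) * dist x y" by simp
  qed
  ultimately show ?thesis unfolding bounded_lipschitz_on_def by blast
qed

lemma bounded_lipschitz_on_power:
  fixes f :: "'a::real_normed_vector \<Rightarrow> real"
  assumes "bounded_lipschitz_on D f"
  shows "bounded_lipschitz_on D (\<lambda>x. f x ^ n)"
  by (induction n) (simp_all add: bounded_lipschitz_on_const
      bounded_lipschitz_on_bilinear[OF bounded_bilinear_mult assms])

text \<open>The only non-polynomial ingredients are inverse powers of the distance, harmless once
  \<open>r\<close> keeps \<open>D\<close> away from collision.\<close>

lemma hamilton_field_lipschitz: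
  assumes D: "bounded D" and r: "r > 0" "\<And>z. z \<in> D \<Longrightarrow> r \<le> norm (snd (fst z))"
  obtains L where "L-lipschitz_on D (\<lambda>z. embed_tangent z (hamilton_field I\<^sub>1 I\<^sub>2 z))"
proof -
  let ?R = "\<lambda>z::phase. snd (fst z)" and ?\<pi> = "\<lambda>z::phase. fst (snd z)" and ?p = "\<lambda>z::phase. snd (snd z)"
  let ?bl = "bounded_lipschitz_on D"
  have B: "?bl (\<lambda>z. fst (fst z))" and R: "?bl ?R" and \<pi>: "?bl ?\<pi>" and p: "?bl ?p"
    by (intro bounded_lipschitz_on_linear[OF _ D] bounded_linear_intros)+
  note cross = bounded_lipschitz_on_bilinear[OF bounded_bilinear_cross3]
  note scale = bounded_lipschitz_on_bilinear[OF bounded_bilinear_scaleR]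
  note mv = bounded_lipschitz_on_compose_linear[OF matrix_vector_mul_bounded_linear]
  note diff = bounded_lipschitz_on_diff and add = bounded_lipschitz_on_add
  have \<Omega>: "?bl (angular_velocity I\<^sub>1 I\<^sub>2)"
    unfolding angular_velocity_def by (intro mv diff cross R \<pi> p)
  have n: "?bl (\<lambda>z. c / norm (?R z) ^ k)" for c :: real and k
  proof -
    have "?bl (\<lambda>z. c * (1 / norm (?R z)) ^ k)"
      by (intro bounded_lipschitz_on_bilinear[OF bounded_bilinear_mult] bounded_lipschitz_on_const
          bounded_lipschitz_on_power bounded_lipschitz_on_inverse_norm[OF R r])
    then show ?thesis by (simp add: power_divide)
  qed
  have g: "?bl (\<lambda>z. grad_potential (inertia I\<^sub>1 I\<^sub>2) (?R z))"
    unfolding grad_potential_def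
    by (intro add diff scale n R mv bounded_lipschitz_on_bilinear[OF bounded_bilinear_mult]
        bounded_lipschitz_on_bilinear[OF bounded_bilinear_inner])
  have "?bl (\<lambda>z. ((fst (fst z) ** hat (angular_velocity I\<^sub>1 I\<^sub>2 z), ?p z - cross3 (angular_velocity I\<^sub>1 I\<^sub>2 z) (?R z)),
      (cross3 (?\<pi> z) (angular_velocity I\<^sub>1 I\<^sub>2 z),
       cross3 (?p z) (angular_velocity I\<^sub>1 I\<^sub>2 z) - grad_potential (inertia I\<^sub>1 I\<^sub>2) (?R z))))"
    by (intro bounded_lipschitz_on_Pair diff cross g R \<pi> p \<Omega> B
        bounded_lipschitz_on_bilinear[OF bounded_bilinear_matrix_matrix]
        bounded_lipschitz_on_compose_linear[OF bounded_linear_hat])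
  then show ?thesis
    using that by (auto simp: bounded_lipschitz_on_def embed_tangent_def hamilton_field_def Let_def)
qed

subsection \<open>Conserved quantities\<close>

text \<open>Derivatives are taken within \<open>T\<close>, so that the lemma serves both compact
  time intervals, before completeness is known, and the whole line.\<close>

lemma first_integral:
  assumes "convex T" "\<And>t. t \<in> T \<Longrightarrow> (\<gamma> has_vector_derivative v t) (at t within T)"
    and F: "\<And>t. t \<in> T \<Longrightarrow> (F has_derivative F' t) (at (\<gamma> t))" "\<And>t. t \<in> T \<Longrightarrow> F' t (v t) = 0"
    and "s \<in> T" "t \<in> T"
  shows "F (\<gamma> s) = F (\<gamma> t)"
proof (rule has_derivative_zero_unique[where f = "\<lambda>t. F (\<gamma> t)", OF \<open>convex T\<close>])
  fix t assume t: "t \<in> T"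
  have "(\<gamma> has_derivative (\<lambda>h. h *\<^sub>R v t)) (at t within T)"
    using assms(2)[OF t] by (simp add: has_vector_derivative_def)
  from has_derivative_compose[OF this F(1)[OF t]]
  show "((\<lambda>t. F (\<gamma> t)) has_derivative (\<lambda>h. 0)) (at t within T)"
    by (simp add: linear_cmul[OF has_derivative_linear[OF F(1)[OF t]]] F(2)[OF t])
qed fact+

text \<open>Noether's theorem by hand. In the spatial part the Euler equation cancels the turning of
  the frame. In the axial part the two equal moments of inertia make spin x \<Omega> orthogonal to
  \<open>e1\<close>, and the gradient is a combination of R and I R, whose cross products with R are
  orthogonal to \<open>e1\<close> as well.\<close>

lemma momentum_derivative_hamilton_field:
  assumes "I\<^sub>1 \<noteq> 0" "I\<^sub>2 \<noteq> 0"
  shows "frechet_derivative momentum (at z) (embed_tangent z (hamilton_field I\<^sub>1 I\<^sub>2 z)) = 0"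
proof -
  obtain B R \<pi> p where z: "z = ((B, R), (\<pi>, p))" by (metis surj_pair)
  define \<Omega> where "\<Omega> = angular_velocity I\<^sub>1 I\<^sub>2 z"
  define g where "g = grad_potential (inertia I\<^sub>1 I\<^sub>2) R"
  have "B *v cross3 \<pi> \<Omega> + (B ** hat \<Omega>) *v \<pi> = B *v (cross3 \<pi> \<Omega> + cross3 \<Omega> \<pi>)"
    by (simp add: matrix_vector_mul_assoc[symmetric] hat_vec matrix_vector_right_distrib)
  then have 1: "B *v cross3 \<pi> \<Omega> + (B ** hat \<Omega>) *v \<pi> = 0"
    by (simp add: cross_skew[of \<Omega>])
  have "cross3 (\<pi> - cross3 R p) \<Omega> \<bullet> e1 = 0"
    by (simp add: \<Omega>_def angular_velocity_def z inertia_mult e1_def inner_axis)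
       (simp add: cross3_def)
  moreover have "cross3 R g \<bullet> e1 = 0"
    by (simp add: g_def grad_potential_def e1_def inner_axis cross_add_right cross_mult_right inertia_mult)
       (simp add: cross3_def)
  moreover have "cross3 R (cross3 p \<Omega> - g) + cross3 (p - cross3 \<Omega> R) p - cross3 \<pi> \<Omega>
      = - cross3 (\<pi> - cross3 R p) \<Omega> - cross3 R g"
    by (simp add: cross3_simps forall_3)
  ultimately have 2: "(cross3 R (cross3 p \<Omega> - g) + cross3 (p - cross3 \<Omega> R) p - cross3 \<pi> \<Omega>) \<bullet> e1 = 0"
    by (simp add: inner_diff_left)
  show ?thesis
    unfolding frechet_derivative_at[OF momentum_has_derivative, symmetric]
    using 1 2 by (simp add: z embed_tangent_def hamilton_field_def Let_def \<Omega>_def[unfolded z] g_def zero_prod_def)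
qed

text \<open>Membership in phase space is assumed only at time \<open>s\<close> and propagated,
  because solutions are constructed in the ambient vector space.\<close>

lemma hamilton_flow_invariants:
  fixes \<gamma> :: "real \<Rightarrow> phase"
  assumes I: "I\<^sub>1 \<noteq> 0" "I\<^sub>2 \<noteq> 0" and T: "convex T"
    and \<gamma>: "\<And>t. t \<in> T \<Longrightarrow> (\<gamma> has_vector_derivative embed_tangent (\<gamma> t) (hamilton_field I\<^sub>1 I\<^sub>2 (\<gamma> t))) (at t within T)"
    and R: "\<And>t. t \<in> T \<Longrightarrow> snd (fst (\<gamma> t)) \<noteq> 0"
    and s: "s \<in> T" "\<gamma> s \<in> phase_space" and t: "t \<in> T"
  shows "hamiltonian (inertia I\<^sub>1 I\<^sub>2) (\<gamma> t) = hamiltonian (inertia I\<^sub>1 I\<^sub>2) (\<gamma> s)"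
    and "momentum (\<gamma> t) = momentum (\<gamma> s)" and "\<gamma> t \<in> phase_space"
proof -
  note fi = first_integral[OF T \<gamma>]
  \<comment> \<open>Energy is conserved because the symplectic form is alternating.\<close>
  have sf: "symplectic_form z X X = 0" for z X
    by (simp add: symplectic_form_def inner_commute)
  show "hamiltonian (inertia I\<^sub>1 I\<^sub>2) (\<gamma> t) = hamiltonian (inertia I\<^sub>1 I\<^sub>2) (\<gamma> s)"
  proof (rule fi[OF _ _ _ t s(1), where F' = "\<lambda>t. frechet_derivative (hamiltonian (inertia I\<^sub>1 I\<^sub>2)) (at (\<gamma> t))"])
    fix t assume "t \<in> T"
    note H = hamiltonian_has_derivative[OF I R[OF this]]
    then show "(hamiltonian (inertia I\<^sub>1 I\<^sub>2) has_derivative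
        frechet_derivative (hamiltonian (inertia I\<^sub>1 I\<^sub>2)) (at (\<gamma> t))) (at (\<gamma> t))"
      by (auto simp: frechet_derivative_works[symmetric] differentiable_def)
    show "frechet_derivative (hamiltonian (inertia I\<^sub>1 I\<^sub>2)) (at (\<gamma> t))
        (embed_tangent (\<gamma> t) (hamilton_field I\<^sub>1 I\<^sub>2 (\<gamma> t))) = 0"
      using symplectic_form_hamilton_field[OF I R[OF \<open>t \<in> T\<close>]] sf by metis
  qed
  show "momentum (\<gamma> t) = momentum (\<gamma> s)"
  proof (rule fi[OF _ _ _ t s(1), where F' = "\<lambda>t. frechet_derivative momentum (at (\<gamma> t))"])
    fix t
    show "(momentum has_derivative frechet_derivative momentum (at (\<gamma> t))) (at (\<gamma> t))"
      using momentum_has_derivative[of "\<gamma> t"]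
      by (auto simp: frechet_derivative_works[symmetric] differentiable_def)
    show "frechet_derivative momentum (at (\<gamma> t)) (embed_tangent (\<gamma> t) (hamilton_field I\<^sub>1 I\<^sub>2 (\<gamma> t))) = 0"
      by (rule momentum_derivative_hamilton_field[OF I])
  qed
  let ?B = "\<lambda>z::phase. fst (fst z)"
  have BB: "?B (\<gamma> t) ** transpose (?B (\<gamma> t)) = mat 1" if "t \<in> T" for t
  proof -
    have "?B (\<gamma> t) ** transpose (?B (\<gamma> t)) = ?B (\<gamma> s) ** transpose (?B (\<gamma> s))"
    proof (rule fi[OF _ _ _ that s(1), where F = "\<lambda>z. ?B z ** transpose (?B z)" and
          F' = "\<lambda>t h. ?B (\<gamma> t) ** transpose (?B h) + ?B h ** transpose (?B (\<gamma> t))"])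
      fix t
      show "((\<lambda>z. ?B z ** transpose (?B z)) has_derivative
          (\<lambda>h. ?B (\<gamma> t) ** transpose (?B h) + ?B h ** transpose (?B (\<gamma> t)))) (at (\<gamma> t))"
        by (auto intro!: derivative_eq_intros)
      have "transpose (hat \<Omega>) + hat \<Omega> = 0" for \<Omega>
        by (simp add: hat_eq transpose_def vec_eq_iff forall_3)
      then have "B ** (transpose (hat \<Omega>) + hat \<Omega>) ** transpose B = 0" for B :: mat3 and \<Omega>
        by (simp add: linear_0[OF linear_mult_left] linear_0[OF linear_mult_right])
      then show "?B (\<gamma> t) ** transpose (?B (embed_tangent (\<gamma> t) (hamilton_field I\<^sub>1 I\<^sub>2 (\<gamma> t)))) +
          ?B (embed_tangent (\<gamma> t) (hamilton_field I\<^sub>1 I\<^sub>2 (\<gamma> t))) ** transpose (?B (\<gamma> t)) = 0"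
        by (simp add: embed_tangent_def matrix_transpose_mul matrix_add_ldistrib matrix_mul_assoc
            linear_add[OF linear_mult_right])
    qed
    also have "\<dots> = mat 1"
      using s(2) by (auto simp: phase_space_def config_space_def SO3_def rotation_matrix_def orthogonal_matrix_def)
    finally show ?thesis .
  qed
  have orth: "orthogonal_matrix (?B (\<gamma> t))" if "t \<in> T" for t
    using BB[OF that] matrix_left_right_inverse by (auto simp: orthogonal_matrix_def)
  \<comment> \<open>The determinant of an orthogonal matrix is 1 or -1; being continuous on a
    connected time set, it cannot jump.\<close>
  have "continuous_on T \<gamma>"
    using \<gamma> by (auto simp: continuous_on_eq_continuous_within dest: has_vector_derivative_continuous)
  then have "continuous_on T (\<lambda>t. det (?B (\<gamma> t)))"
    unfolding det_3 by (intro continuous_intros)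
  moreover have "(\<lambda>t. det (?B (\<gamma> t))) ` T \<subseteq> {1, -1}"
    using det_orthogonal_matrix orth by blast
  then have "finite ((\<lambda>t. det (?B (\<gamma> t))) ` T)"
    by (rule finite_subset) simp
  ultimately have "(\<lambda>t. det (?B (\<gamma> t))) constant_on T"
    by (rule continuous_finite_range_constant[OF convex_connected[OF T]])
  then have "det (?B (\<gamma> t)) = det (?B (\<gamma> s))"
    using s(1) t by (auto simp: constant_on_def)
  also have "\<dots> = 1"
    using s(2) by (auto simp: phase_space_def config_space_def SO3_def rotation_matrix_def)
  finally show "\<gamma> t \<in> phase_space"
    using orth[OF t] R[OF t]
    by (auto simp: phase_space_def config_space_def SO3_def rotation_matrix_def mem_Times_iff)
qed


subsection \<open>The amended potential\<close>

text \<open>The first term is the energy of rigid rotation with moment of inertia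
  \<open>I\<^sub>2 + r\<^sup>2\<close> and angular momentum \<open>m\<close>; the rest is
  \<open>potential\<close> at a position on the symmetry axis.\<close>

definition amended_potential :: "real \<Rightarrow> real \<Rightarrow> real \<Rightarrow> real \<Rightarrow> real" where
  "amended_potential I\<^sub>1 I\<^sub>2 m r = m\<^sup>2 / (2 * (I\<^sub>2 + r\<^sup>2)) - 1 / r - (1 - 3 * I\<^sub>1) / (2 * r ^ 3)"

text \<open>To be read with \<open>A\<close>, \<open>C\<close> the squared norms of spin L and
  orbital angular momentum l, and \<open>B\<close> their inner product. The last numerator is then
  the squared norm of \<open>r\<^sup>2 L - j l\<close>, which vanishes exactly when both rotate with
  the same angular velocity.\<close>

lemma kinetic_splitting:
  fixes A B C j r :: real
  assumes "j > 0" "r > 0"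
  shows "A / (2 * j) + C / (2 * r\<^sup>2) = (A + 2 * B + C) / (2 * (j + r\<^sup>2))
    + (r ^ 4 * A - 2 * r\<^sup>2 * j * B + j\<^sup>2 * C) / (2 * j * r\<^sup>2 * (j + r\<^sup>2))"
proof -
  have "j + r\<^sup>2 > 0" using assms by (simp add: add_pos_pos)
  then show ?thesis using assms by (simp add: divide_simps) (simp add: algebra_simps eval_nat_numeral)
qed

text \<open>On the level set of vanishing axial spin the kinetic energy of the body only involves the
  transverse inertia, so completing squares exhibits the energy as the amended potential plus
  nonnegative terms.\<close>

lemma hamiltonian_splitting:
  fixes B :: mat3 and R \<pi> p :: vec3
  assumes I: "0 < I\<^sub>1" "0 < I\<^sub>2" "I\<^sub>1 + 2 * I\<^sub>2 = 1" and R: "R \<noteq> 0"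
    and axial: "(cross3 R p - \<pi>) \<bullet> e1 = 0"
  shows "hamiltonian (inertia I\<^sub>1 I\<^sub>2) ((B, R), (\<pi>, p)) = amended_potential I\<^sub>1 I\<^sub>2 (norm \<pi>) (norm R)
    + (norm ((norm R)\<^sup>2 *\<^sub>R (\<pi> - cross3 R p) - I\<^sub>2 *\<^sub>R cross3 R p))\<^sup>2
        / (2 * I\<^sub>2 * (norm R)\<^sup>2 * (I\<^sub>2 + (norm R)\<^sup>2))
    + (R \<bullet> p)\<^sup>2 / (2 * (norm R)\<^sup>2)
    + 3 * (I\<^sub>2 - I\<^sub>1) * ((R$2)\<^sup>2 + (R$3)\<^sup>2) / (2 * norm R ^ 5)"
proof -
  define r where "r = norm R"
  define l where "l = cross3 R p"
  define L where "L = \<pi> - l"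
  have r: "r > 0" using R by (simp add: r_def)
  have L1: "L $ 1 = 0" using axial by (simp add: L_def l_def e1_def inner_axis)
  have kin: "L \<bullet> angular_velocity I\<^sub>1 I\<^sub>2 ((B, R), (\<pi>, p)) = (L \<bullet> L) / I\<^sub>2"
    using L1 I by (simp add: angular_velocity_def inertia_inner L_def[symmetric] l_def[symmetric])
      (simp add: inner_vec_def sum_3 L1 add_divide_distrib)
  have rr: "r\<^sup>2 = (R$1)\<^sup>2 + (R$2)\<^sup>2 + (R$3)\<^sup>2"
    by (simp only: r_def power2_norm_eq_inner) (simp add: inner_vec_def sum_3 power2_eq_square)
  \<comment> \<open>Lagrange's identity separates the orbital from the radial part of the linear
    momentum.\<close>
  have "l \<bullet> l + (R \<bullet> p)\<^sup>2 = r\<^sup>2 * (p \<bullet> p)"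
    using norm_cross_dot[of R p] by (simp add: l_def r_def power_mult_distrib power2_norm_eq_inner)
  then have pp: "p \<bullet> p = (l \<bullet> l) / r\<^sup>2 + (R \<bullet> p)\<^sup>2 / r\<^sup>2"
    using r by (simp add: field_simps)
  have \<pi>: "(norm \<pi>)\<^sup>2 = L \<bullet> L + 2 * (L \<bullet> l) + l \<bullet> l"
    by (simp add: L_def power2_norm_eq_inner inner_diff_left inner_diff_right inner_commute)
  have sq: "(norm (r\<^sup>2 *\<^sub>R L - I\<^sub>2 *\<^sub>R l))\<^sup>2 = r ^ 4 * (L \<bullet> L) - 2 * r\<^sup>2 * I\<^sub>2 * (L \<bullet> l) + I\<^sub>2\<^sup>2 * (l \<bullet> l)"
    by (simp add: power2_norm_eq_inner inner_diff_left inner_diff_right inner_commute)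
       (simp add: algebra_simps eval_nat_numeral)
  have V: "potential (inertia I\<^sub>1 I\<^sub>2) R = - 1 / r - (1 - 3 * I\<^sub>1) / (2 * r ^ 3)
      + 3 * (I\<^sub>2 - I\<^sub>1) * ((R$2)\<^sup>2 + (R$3)\<^sup>2) / (2 * r ^ 5)"
  proof -
    have Q: "R \<bullet> (inertia I\<^sub>1 I\<^sub>2 *v R) = I\<^sub>1 * r\<^sup>2 + (I\<^sub>2 - I\<^sub>1) * ((R$2)\<^sup>2 + (R$3)\<^sup>2)"
      unfolding rr by (simp add: inertia_inner algebra_simps power2_eq_square)
    show ?thesis
      unfolding potential_def r_def[symmetric] Q using r by (simp add: field_simps eval_nat_numeral)
  qed
  have "hamiltonian (inertia I\<^sub>1 I\<^sub>2) ((B, R), (\<pi>, p))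
      = (L \<bullet> L) / (2 * I\<^sub>2) + (l \<bullet> l) / (2 * r\<^sup>2) + (R \<bullet> p)\<^sup>2 / (2 * r\<^sup>2) + potential (inertia I\<^sub>1 I\<^sub>2) R"
    using I kin r by (simp add: hamiltonian_eq L_def[symmetric] l_def[symmetric] pp add_divide_distrib)
  then show ?thesis
    unfolding kinetic_splitting[OF I(2) r, of "L \<bullet> L" "l \<bullet> l" "L \<bullet> l"] V
    by (simp add: amended_potential_def \<pi> sq r_def[symmetric] l_def[symmetric] L_def[symmetric])
qed

text \<open>Differentiability of \<open>f'\<close> at the single point \<open>a\<close> makes it
  change sign there, so \<open>f\<close> strictly decreases before \<open>a\<close> and strictly
  increases after it.\<close>

lemma strict_local_min_second_derivative:
  fixes f :: "real \<Rightarrow> real"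
  assumes e: "e > 0" and f: "\<And>x. \<bar>x - a\<bar> < e \<Longrightarrow> (f has_real_derivative f' x) (at x)"
    and f': "f' a = 0" "(f' has_real_derivative d) (at a)" "d > 0"
  obtains \<rho> where "0 < \<rho>" "\<rho> \<le> e" "\<And>x. \<bar>x - a\<bar> < \<rho> \<Longrightarrow> f x \<le> f a \<Longrightarrow> x = a"
proof -
  obtain d1 where d1: "d1 > 0" "\<And>h. 0 < h \<Longrightarrow> h < d1 \<Longrightarrow> f' a < f' (a + h)"
    using DERIV_pos_inc_right[OF f'(2,3)] by blast
  obtain d2 where d2: "d2 > 0" "\<And>h. 0 < h \<Longrightarrow> h < d2 \<Longrightarrow> f' (a - h) < f' a"
    using DERIV_pos_inc_left[OF f'(2,3)] by blast
  define \<rho> where "\<rho> = Min {e, d1, d2}"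
  have \<rho>: "0 < \<rho>" "\<rho> \<le> e" "\<rho> \<le> d1" "\<rho> \<le> d2" using e d1(1) d2(1) by (auto simp: \<rho>_def)
  have "f a < f x" if "\<bar>x - a\<bar> < \<rho>" "x \<noteq> a" for x
  proof (cases "a < x")
    case True
    then show ?thesis
    proof (rule DERIV_pos_imp_increasing_open)
      show "\<exists>y. (f has_real_derivative y) (at z) \<and> 0 < y" if "a < z" "z < x" for z
        using f[of z] d1(2)[of "z - a"] f'(1) that \<open>\<bar>x - a\<bar> < \<rho>\<close> \<rho> by auto
      show "continuous_on {a..x} f"
        by (rule continuous_at_imp_continuous_on)
           (use f DERIV_isCont \<open>\<bar>x - a\<bar> < \<rho>\<close> \<rho> in force)
    qed
  next
    case False
    then have "x < a" using that by simp
    then show ?thesis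
    proof (rule DERIV_neg_imp_decreasing_open)
      show "\<exists>y. (f has_real_derivative y) (at z) \<and> y < 0" if "x < z" "z < a" for z
        using f[of z] d2(2)[of "a - z"] f'(1) that \<open>\<bar>x - a\<bar> < \<rho>\<close> \<rho> by auto
      show "continuous_on {x..a} f"
        by (rule continuous_at_imp_continuous_on)
           (use f DERIV_isCont \<open>\<bar>x - a\<bar> < \<rho>\<close> \<rho> in force)
    qed
  qed
  then show ?thesis using that \<rho> by (metis not_less)
qed

text \<open>The derivative vanishes at \<open>R\<close> by the value of \<open>w\<^sup>2\<close>,
  which expresses radial force balance. Clearing \<open>R ^ 5 * (I\<^sub>2 + R\<^sup>2)\<close> from
  the second derivative leaves the difference of the two sides of \<open>large\<close>. The bound
  \<open>R / 2\<close> keeps the collision \<open>r = 0\<close> out.\<close>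

lemma amended_potential_strict_min:
  assumes I: "0 < I\<^sub>2" "I\<^sub>1 + 2 * I\<^sub>2 = 1" and R: "0 < R"
    and w: "w\<^sup>2 = (2 * R\<^sup>2 + 3 - 9 * I\<^sub>1) / (2 * R ^ 5)"
    and large: "R ^ 4 > 3 * R\<^sup>2 * (2 * I\<^sub>2 - I\<^sub>1) + 15 * I\<^sub>2 * (I\<^sub>2 - I\<^sub>1)"
    and m: "m\<^sup>2 = ((I\<^sub>2 + R\<^sup>2) * w)\<^sup>2"
  obtains \<rho> where "0 < \<rho>" "\<rho> \<le> R / 2"
    "\<And>r. \<bar>r - R\<bar> < \<rho> \<Longrightarrow> amended_potential I\<^sub>1 I\<^sub>2 m r \<le> amended_potential I\<^sub>1 I\<^sub>2 m R \<Longrightarrow> r = R"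
proof (rule strict_local_min_second_derivative)
  define W' where "W' r = - m\<^sup>2 * r / (I\<^sub>2 + r\<^sup>2)\<^sup>2 + 1 / r\<^sup>2 + 3 * (1 - 3 * I\<^sub>1) / (2 * r ^ 4)" for r
  have pos: "I\<^sub>2 + r\<^sup>2 > 0" for r using I by (simp add: add_pos_nonneg)
  show "(amended_potential I\<^sub>1 I\<^sub>2 m has_real_derivative W' r) (at r)" if "\<bar>r - R\<bar> < R / 2" for r
  proof -
    have "r > 0" using that R by (simp add: abs_if split: if_splits)
    moreover have "I\<^sub>2 + r\<^sup>2 \<noteq> 0" using pos[of r] by simp
    ultimately show ?thesis
      unfolding amended_potential_def W'_def
      by (auto intro!: derivative_eq_intros)
         (simp add: divide_simps, simp add: algebra_simps eval_nat_numeral)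
  qed
  have I1: "I\<^sub>1 = 1 - 2 * I\<^sub>2" using I by simp
  have mw: "m\<^sup>2 = (I\<^sub>2 + R\<^sup>2)\<^sup>2 * w\<^sup>2" using m by (simp add: power_mult_distrib)
  have "W' R = - w\<^sup>2 * R + 1 / R\<^sup>2 + 3 * (1 - 3 * I\<^sub>1) / (2 * R ^ 4)"
    using pos[of R] by (simp add: W'_def mw)
  also have "\<dots> = 0" using R unfolding w by (simp add: field_simps eval_nat_numeral)
  finally show "W' R = 0" .
  show "(W' has_real_derivative w\<^sup>2 * (3 * R\<^sup>2 - I\<^sub>2) / (I\<^sub>2 + R\<^sup>2) - 2 / R ^ 3 - 6 * (1 - 3 * I\<^sub>1) / R ^ 5) (at R)"
  proof -
    have "(W' has_real_derivative m\<^sup>2 * (3 * R\<^sup>2 - I\<^sub>2) / (I\<^sub>2 + R\<^sup>2) ^ 3 - 2 / R ^ 3 - 6 * (1 - 3 * I\<^sub>1) / R ^ 5) (at R)"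
      unfolding W'_def using pos[of R] R
      by (auto intro!: derivative_eq_intros)
         (simp add: divide_simps, simp add: algebra_simps eval_nat_numeral)
    moreover have "m\<^sup>2 * (3 * R\<^sup>2 - I\<^sub>2) / (I\<^sub>2 + R\<^sup>2) ^ 3 = w\<^sup>2 * (3 * R\<^sup>2 - I\<^sub>2) / (I\<^sub>2 + R\<^sup>2)"
      using pos[of R] unfolding mw by (simp add: power2_eq_square power3_eq_cube)
    ultimately show ?thesis by simp
  qed
  have "w\<^sup>2 * (3 * R\<^sup>2 - I\<^sub>2) / (I\<^sub>2 + R\<^sup>2) - 2 / R ^ 3 - 6 * (1 - 3 * I\<^sub>1) / R ^ 5
     = (R ^ 4 - 3 * R\<^sup>2 * (2 * I\<^sub>2 - I\<^sub>1) - 15 * I\<^sub>2 * (I\<^sub>2 - I\<^sub>1)) / (R ^ 5 * (I\<^sub>2 + R\<^sup>2))"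
    using R pos[of R] unfolding w I1 by (simp add: divide_simps) (simp add: algebra_simps eval_nat_numeral)
  also have "\<dots> > 0" using large R pos[of R] by simp
  finally show "w\<^sup>2 * (3 * R\<^sup>2 - I\<^sub>2) / (I\<^sub>2 + R\<^sup>2) - 2 / R ^ 3 - 6 * (1 - 3 * I\<^sub>1) / R ^ 5 > 0" .
qed (use R that in auto)

subsection \<open>Stability of prolate bodies\<close>

lemma norm_orthogonal_matrix_vector:
  fixes B :: mat3
  assumes "orthogonal_matrix B"
  shows "norm (B *v x) = norm x"
  using assms by (simp add: orthogonal_transformation_matrix orthogonal_transformation_norm)

text \<open>Three unit rows give the crude bound 3, which suffices for compactness.\<close>

lemma SO3_bounded: "B \<in> SO3 \<Longrightarrow> norm B \<le> 3"
proof -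
  assume "B \<in> SO3"
  then have "norm (B $ i) = 1" for i
    by (auto simp: SO3_def rotation_matrix_def orthogonal_matrix_orthonormal_rows row_def)
  moreover have "norm B \<le> (\<Sum>i\<in>UNIV. norm (B $ i))"
    unfolding norm_vec_def by (rule L2_set_le_sum) simp
  ultimately show "norm B \<le> 3" by (simp add: sum_3)
qed

lemma compact_SO3: "compact SO3"
proof -
  have SO3: "SO3 = {B. transpose B ** B = mat 1} \<inter> {B. B ** transpose B = mat 1} \<inter> {B. det B = 1}"
    by (auto simp: SO3_def rotation_matrix_def orthogonal_matrix_def)
  have mult: "closed {B::mat3. transpose B ** B = mat 1}" "closed {B::mat3. B ** transpose B = mat 1}"
    by (intro closed_Collect_eq continuous_on_const
        bounded_bilinear.continuous_on[OF bounded_bilinear_matrix_matrix]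
        bounded_linear.continuous_on[OF bounded_linear_transpose] continuous_on_id)+
  have "closed {B::mat3. det B = 1}"
    unfolding det_3 by (intro closed_Collect_eq continuous_intros)
  then have "closed SO3" unfolding SO3 by (intro closed_Int mult)
  moreover have "bounded SO3" using SO3_bounded by (auto simp: bounded_iff)
  ultimately show ?thesis by (simp add: compact_eq_bounded_closed)
qed

lemma norm_vector_2: "norm (vector [0, a, 0] :: vec3) = \<bar>a\<bar>"
  by (simp add: norm_eq_sqrt_inner inner_vec_def sum_3)

lemma momentum_rel_eq: "momentum (rel_eq j R w) = (vector [0, (j + R\<^sup>2) * w, 0], 0)"
  by (simp add: rel_eq_def momentum_eq e1_def inner_axis) (simp add: cross3_def)

text \<open>All the nonnegative terms of the splitting vanish at the equilibrium.\<close>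

lemma hamiltonian_rel_eq:
  assumes "0 < I\<^sub>1" "0 < I\<^sub>2" "I\<^sub>1 + 2 * I\<^sub>2 = 1" "0 < R"
  shows "hamiltonian (inertia I\<^sub>1 I\<^sub>2) (rel_eq I\<^sub>2 R w) = amended_potential I\<^sub>1 I\<^sub>2 ((I\<^sub>2 + R\<^sup>2) * w) R"
proof -
  let ?R = "vector [R, 0, 0] :: vec3" and ?p = "vector [0, 0, - (R * w)] :: vec3"
    and ?\<pi> = "vector [0, (I\<^sub>2 + R\<^sup>2) * w, 0] :: vec3"
  have c: "cross3 ?R ?p = vector [0, R\<^sup>2 * w, 0]"
    by (simp add: cross3_def vec_eq_iff forall_3 power2_eq_square)
  have "?R \<noteq> 0" using assms by (simp add: vec_eq_iff forall_3)
  moreover have "(cross3 ?R ?p - ?\<pi>) \<bullet> e1 = 0" by (simp add: c e1_def inner_axis)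
  moreover have "R\<^sup>2 *\<^sub>R (?\<pi> - cross3 ?R ?p) - I\<^sub>2 *\<^sub>R cross3 ?R ?p = 0"
    by (simp add: c vec_eq_iff forall_3 algebra_simps)
  moreover have "?R \<bullet> ?p = 0" by (simp add: inner_vec_def sum_3)
  moreover have "(norm ?\<pi>)\<^sup>2 = ((I\<^sub>2 + R\<^sup>2) * w)\<^sup>2"
    by (simp add: norm_vector_2)
  ultimately show ?thesis
    using hamiltonian_splitting[OF assms(1-3), of ?R ?p ?\<pi> "mat 1"] assms(4)
    by (simp add: rel_eq_def norm_vector_1 amended_potential_def)
qed

text \<open>Equal energies force every term of the splitting to its minimum: \<open>X1 = 0\<close>
  locks the body to the orbital rotation, \<open>X2 = 0\<close> removes radial momentum, and
  \<open>X3 = 0\<close> puts the position on the symmetry axis, the body being prolate. What remains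
  is the attitude and the angle of \<pi> about \<open>e1\<close>, and the symmetry group absorbs
  both.\<close>

lemma rel_eq_level_set:
  fixes I\<^sub>1 I\<^sub>2 R w :: real and z :: phase
  assumes I: "0 < I\<^sub>1" "0 < I\<^sub>2" "I\<^sub>1 + 2 * I\<^sub>2 = 1" "I\<^sub>1 < I\<^sub>2" and R: "0 < R" and w: "w \<noteq> 0"
    and min: "\<And>r. \<bar>r - R\<bar> \<le> \<rho> \<Longrightarrow> amended_potential I\<^sub>1 I\<^sub>2 ((I\<^sub>2 + R\<^sup>2) * w) r
        \<le> amended_potential I\<^sub>1 I\<^sub>2 ((I\<^sub>2 + R\<^sup>2) * w) R \<Longrightarrow> r = R"
    and z: "z \<in> phase_space" "dist (snd (fst z)) (vector [R, 0, 0]) \<le> \<rho>" and \<rho>: "\<rho> < R"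
    and H: "hamiltonian (inertia I\<^sub>1 I\<^sub>2) z = hamiltonian (inertia I\<^sub>1 I\<^sub>2) (rel_eq I\<^sub>2 R w)"
    and J: "momentum z = momentum (rel_eq I\<^sub>2 R w)"
  shows "snd (fst z) = vector [R, 0, 0]"
    and "z \<in> (\<lambda>g. act_phase g (rel_eq I\<^sub>2 R w)) ` stabilizer (momentum (rel_eq I\<^sub>2 R w))"
proof -
  obtain B Q \<pi> p where z': "z = ((B, Q), (\<pi>, p))" by (metis surj_pair)
  let ?m = "(I\<^sub>2 + R\<^sup>2) * w" and ?W = "amended_potential I\<^sub>1 I\<^sub>2 ((I\<^sub>2 + R\<^sup>2) * w)"
  have Q0: "Q \<noteq> 0" and B: "orthogonal_matrix B" "det B = 1"
    using z(1) by (auto simp: z' phase_space_def config_space_def SO3_def rotation_matrix_def)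
  have J1: "B *v \<pi> = vector [0, ?m, 0]" and J2: "(cross3 Q p - \<pi>) \<bullet> e1 = 0"
    using J by (simp_all add: z' momentum_rel_eq momentum_eq)
  have jpos: "I\<^sub>2 + R\<^sup>2 > 0" using I by (simp add: add_pos_nonneg)
  have m0: "?m \<noteq> 0" using jpos w by simp
  have "norm \<pi> = norm (vector [0, ?m, 0] :: vec3)"
    using norm_orthogonal_matrix_vector[OF B(1), of \<pi>] J1 by simp
  then have "(norm \<pi>)\<^sup>2 = ?m\<^sup>2"
    by (simp add: norm_vector_2)
  then have W: "amended_potential I\<^sub>1 I\<^sub>2 (norm \<pi>) r = ?W r" for r
    by (simp add: amended_potential_def)
  define X1 where "X1 = (norm ((norm Q)\<^sup>2 *\<^sub>R (\<pi> - cross3 Q p) - I\<^sub>2 *\<^sub>R cross3 Q p))\<^sup>2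
        / (2 * I\<^sub>2 * (norm Q)\<^sup>2 * (I\<^sub>2 + (norm Q)\<^sup>2))"
  define X2 where "X2 = (Q \<bullet> p)\<^sup>2 / (2 * (norm Q)\<^sup>2)"
  define X3 where "X3 = 3 * (I\<^sub>2 - I\<^sub>1) * ((Q$2)\<^sup>2 + (Q$3)\<^sup>2) / (2 * norm Q ^ 5)"
  have eq: "?W (norm Q) + X1 + X2 + X3 = ?W R"
    using H hamiltonian_splitting[OF I(1-3) Q0 J2, of B] hamiltonian_rel_eq[OF I(1-3) R, of w]
    by (simp add: z' W X1_def X2_def X3_def)
  have nn: "0 \<le> X1" "0 \<le> X2" "0 \<le> X3" using I by (auto simp: X1_def X2_def X3_def)
  have "norm (vector [R, 0, 0] :: vec3) = R" using R by (simp add: norm_vector_1)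
  then have "\<bar>norm Q - R\<bar> \<le> norm (Q - vector [R, 0, 0])"
    by (metis norm_triangle_ineq3)
  also have "\<dots> \<le> \<rho>" using z(2) by (simp add: z' dist_norm)
  finally have nQ: "norm Q = R" using min[of "norm Q"] eq nn by auto
  have X: "X1 = 0" "X2 = 0" "X3 = 0" using eq nn nQ by auto
  \<comment> \<open>The norm leaves the sign of the first coordinate open; closeness to the
    equilibrium excludes the opposite position.\<close>
  have "\<bar>(Q - vector [R, 0, 0]) $ 1\<bar> \<le> \<rho>"
    using component_le_norm_cart[of "Q - vector [R, 0, 0]" 1] z(2) by (simp add: z' dist_norm)
  then have Q1: "Q $ 1 > 0" using \<rho> by simp
  have "(Q$2)\<^sup>2 + (Q$3)\<^sup>2 = 0" using X(3) I R by (simp add: X3_def nQ)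
  then have Q23: "Q $ 2 = 0" "Q $ 3 = 0" by (simp_all add: sum_power2_eq_zero_iff)
  have "(norm Q)\<^sup>2 = (Q$1)\<^sup>2"
    by (simp only: power2_norm_eq_inner) (simp add: inner_vec_def sum_3 Q23 power2_eq_square)
  then have "Q $ 1 = R" using nQ Q1 R by (simp add: power2_eq_iff)
  then have Q: "Q = vector [R, 0, 0]" using Q23 by (simp add: vec_eq_iff forall_3)
  then show "snd (fst z) = vector [R, 0, 0]" by (simp add: z')
  have "R * p $ 1 = 0" using X(2) R by (simp add: X2_def nQ) (simp add: Q inner_vec_def sum_3)
  then have p1: "p $ 1 = 0" using R by simp
  have \<ell>: "cross3 Q p = vector [0, - (R * p $ 3), R * p $ 2]"
    by (simp add: Q cross3_def vec_eq_iff forall_3)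
  have "R\<^sup>2 *\<^sub>R (\<pi> - cross3 Q p) = I\<^sub>2 *\<^sub>R cross3 Q p"
    using X(1) I R jpos by (simp add: X1_def nQ)
  then have \<pi>1: "\<pi> $ 1 = 0" and "R\<^sup>2 * (\<pi> $ 2 + R * p $ 3) = - I\<^sub>2 * (R * p $ 3)"
    and "R\<^sup>2 * (\<pi> $ 3 - R * p $ 2) = I\<^sub>2 * (R * p $ 2)"
    using R by (simp_all add: \<ell> vec_eq_iff forall_3)
  then have "R * (R * \<pi> $ 2) = R * (- (I\<^sub>2 + R\<^sup>2) * p $ 3)" "R * (R * \<pi> $ 3) = R * ((I\<^sub>2 + R\<^sup>2) * p $ 2)"
    by (simp_all add: algebra_simps power2_eq_square)
  then have "R * \<pi> $ 2 = - (I\<^sub>2 + R\<^sup>2) * p $ 3" "R * \<pi> $ 3 = (I\<^sub>2 + R\<^sup>2) * p $ 2"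
    using R by simp_all
  then have p23: "p $ 2 = R * \<pi> $ 3 / (I\<^sub>2 + R\<^sup>2)" "p $ 3 = - (R * \<pi> $ 2 / (I\<^sub>2 + R\<^sup>2))"
    using jpos by (simp_all add: field_simps)
  \<comment> \<open>Cosine and sine of the angle by which \<pi> is turned about \<open>e1\<close>
    from its value at the equilibrium.\<close>
  define c where "c = \<pi> $ 2 / ?m"
  define s where "s = \<pi> $ 3 / ?m"
  have "(\<pi> $ 2)\<^sup>2 + (\<pi> $ 3)\<^sup>2 = ?m\<^sup>2"
    using \<open>(norm \<pi>)\<^sup>2 = ?m\<^sup>2\<close> \<pi>1
    by (simp only: power2_norm_eq_inner) (simp add: inner_vec_def sum_3 power2_eq_square)
  then have cs: "c * c + s * s = 1"
    using m0 by (simp add: c_def s_def power2_eq_square add_divide_distrib[symmetric])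
  define O2 :: "real^2^2" where "O2 = vector [vector [c, - s], vector [s, c]]"
  have "orthogonal_matrix O2"
    using cs by (simp add: orthogonal_matrix O2_def vec_eq_iff forall_2 matrix_matrix_mult_def
        sum_2 transpose_def mat_def algebra_simps)
  define N where "N = block 1 O2"
  have N: "N \<in> Gamma_axi" unfolding N_def by (rule block_in_Gamma_axi) fact
  have Neq: "N = vector [vector [1, 0, 0], vector [0, c, - s], vector [0, s, c]]"
    by (simp add: N_def block_def O2_def)
  have detN: "det N = 1" using cs by (simp add: Neq det_3)
  have NN: "orthogonal_matrix N"
    using cs by (simp add: orthogonal_matrix Neq vec_eq_iff forall_3 matrix_matrix_mult_def
        sum_3 transpose_def mat_def algebra_simps)
  have N\<pi>: "N *v vector [0, ?m, 0] = \<pi>"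
    using m0 \<pi>1 by (simp add: Neq vec_eq_iff forall_3 matrix_vector_mult_def sum_3 c_def s_def)
  have Np: "N *v vector [0, 0, - (R * w)] = p"
    using p1 w jpos by (simp add: Neq vec_eq_iff forall_3 matrix_vector_mult_def sum_3 c_def s_def p23)
  have NQ: "N *v vector [R, 0, 0] = Q"
    by (simp add: Neq Q vec_eq_iff forall_3 matrix_vector_mult_def sum_3)
  \<comment> \<open>\<open>(M, N)\<close> takes the identity attitude to
    \<open>M ** transpose N\<close>, which forces \<open>M = B ** N\<close>. It fixes the spatial
    momentum: \<open>N\<close> sends the reference value to \<pi>, and \<open>B\<close> sends \<pi>
    back.\<close>
  have "rotation_matrix (B ** N)"
    using B NN detN by (simp add: rotation_matrix_def orthogonal_matrix_mul det_mul)
  then have M: "B ** N \<in> SO3" by (simp add: SO3_def)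
  have "(B ** N) *v vector [0, ?m, 0] = vector [0, ?m, 0]"
    by (simp only: matrix_vector_mul_assoc[symmetric] N\<pi> J1)
  then have "(B ** N, N) \<in> stabilizer (momentum (rel_eq I\<^sub>2 R w))"
    using M N by (simp add: stabilizer_def G_axi_def coadjoint_def momentum_rel_eq)
  moreover have "B ** N ** mat 1 ** transpose N = B"
    using NN by (simp add: orthogonal_matrix_def matrix_mul_assoc[symmetric])
  then have "act_phase (B ** N, N) (rel_eq I\<^sub>2 R w) = z"
    by (simp add: act_phase_def act_config_def act_tangent_def rel_eq_def z' detN N\<pi> Np NQ)
  ultimately show "z \<in> (\<lambda>g. act_phase g (rel_eq I\<^sub>2 R w)) ` stabilizer (momentum (rel_eq I\<^sub>2 R w))"
    by (metis image_eqI)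
qed

section \<open>Compactness and confinement\<close>

lemma norm_momentum:
  assumes "z \<in> phase_space"
  shows "norm (fst (snd z)) = norm (fst (momentum z))"
  using assms norm_orthogonal_matrix_vector
  by (auto simp: momentum_components phase_space_def config_space_def SO3_def rotation_matrix_def)

lemma hamiltonian_continuous_on:
  assumes "I\<^sub>1 \<noteq> 0" "I\<^sub>2 \<noteq> 0" "\<And>z. z \<in> S \<Longrightarrow> snd (fst z) \<noteq> 0"
  shows "continuous_on S (hamiltonian (inertia I\<^sub>1 I\<^sub>2))"
  by (rule continuous_at_imp_continuous_on)
     (use has_derivative_continuous[OF hamiltonian_has_derivative[OF assms(1,2)]] assms(3) in auto)

lemma momentum_continuous_on: "continuous_on S momentum"
  by (rule continuous_at_imp_continuous_on)
     (use has_derivative_continuous[OF momentum_has_derivative] in auto)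

text \<open>The spin energy is nonnegative, so the square of the linear momentum is at most
  \<open>2 * (h + v)\<close>; the summand 1 comes from \<open>2 * a \<le> a\<^sup>2 + 1\<close>,
  which avoids a square root.\<close>

lemma hamiltonian_coercive:
  assumes I: "0 < I\<^sub>1" "0 < I\<^sub>2" and H: "hamiltonian (inertia I\<^sub>1 I\<^sub>2) z \<le> h"
    and V: "- v \<le> potential (inertia I\<^sub>1 I\<^sub>2) (snd (fst z))"
  shows "norm (snd (snd z)) \<le> 2 * (h + v) + 1"
proof -
  let ?p = "snd (snd z)"
  have "0 \<le> L \<bullet> (inertia (1/I\<^sub>1) (1/I\<^sub>2) *v L)" for L
    using I by (simp add: inertia_inner)
  then have "(?p \<bullet> ?p) / 2 + potential (inertia I\<^sub>1 I\<^sub>2) (snd (fst z)) \<le> h"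
    using H I by (simp add: hamiltonian_eq angular_velocity_def add_divide_distrib) (smt (verit) divide_nonneg_pos)
  then have *: "(norm ?p)\<^sup>2 \<le> 2 * (h + v)"
    using V by (simp add: power2_norm_eq_inner)
  have "0 \<le> (norm ?p - 1)\<^sup>2" by simp
  then have "2 * norm ?p \<le> (norm ?p)\<^sup>2 + 1" by (simp add: power2_diff)
  then show ?thesis using * norm_ge_zero[of ?p] by linarith
qed


theorem rel_eq_stable:
  fixes I\<^sub>1 I\<^sub>2 R w :: real
  assumes I: "0 < I\<^sub>1" "0 < I\<^sub>2" "I\<^sub>1 + 2 * I\<^sub>2 = 1" "I\<^sub>1 < I\<^sub>2" and R: "0 < R"
    and w: "w\<^sup>2 = (2 * R\<^sup>2 + 3 - 9 * I\<^sub>1) / (2 * R ^ 5)" "w \<noteq> 0"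
    and large: "R ^ 4 > 3 * R\<^sup>2 * (2 * I\<^sub>2 - I\<^sub>1) + 15 * I\<^sub>2 * (I\<^sub>2 - I\<^sub>1)"
  shows "Gmu_stable (inertia I\<^sub>1 I\<^sub>2) (rel_eq I\<^sub>2 R w)"
proof -
  let ?I = "inertia I\<^sub>1 I\<^sub>2" and ?R = "vector [R, 0, 0] :: vec3" and ?p = "rel_eq I\<^sub>2 R w"
  let ?H = "hamiltonian ?I" and ?X = "\<lambda>z. embed_tangent z (hamilton_field I\<^sub>1 I\<^sub>2 z)"
  let ?orbit = "(\<lambda>g. act_phase g ?p) ` stabilizer (momentum ?p)"
  have I0: "I\<^sub>1 \<noteq> 0" "I\<^sub>2 \<noteq> 0" using I by auto
  obtain \<rho>' where \<rho>': "0 < \<rho>'" "\<rho>' \<le> R / 2"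
    "\<And>r. \<bar>r - R\<bar> < \<rho>' \<Longrightarrow> amended_potential I\<^sub>1 I\<^sub>2 ((I\<^sub>2 + R\<^sup>2) * w) r
        \<le> amended_potential I\<^sub>1 I\<^sub>2 ((I\<^sub>2 + R\<^sup>2) * w) R \<Longrightarrow> r = R"
    using amended_potential_strict_min[OF I(2,3) R w(1) large refl] by blast
  \<comment> \<open>Halved so that the strict minimum is available on the closed ball.\<close>
  define \<rho> where "\<rho> = \<rho>' / 2"
  have \<rho>: "0 < \<rho>" "\<rho> < R" "R / 2 \<le> R - \<rho>" using \<rho>'(1,2) R by (auto simp: \<rho>_def)
  have min: "r = R" if "\<bar>r - R\<bar> \<le> \<rho>" "amended_potential I\<^sub>1 I\<^sub>2 ((I\<^sub>2 + R\<^sup>2) * w) r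
        \<le> amended_potential I\<^sub>1 I\<^sub>2 ((I\<^sub>2 + R\<^sup>2) * w) R" for r
    using \<rho>'(1) \<rho>'(3)[of r] that by (simp add: \<rho>_def)
  have far: "R / 2 \<le> norm Q" if "dist Q ?R \<le> \<rho>" for Q
    using norm_triangle_ineq2[of ?R Q] that \<rho>(3) R by (simp add: norm_vector_1 dist_norm norm_minus_commute)
  then have nz: "Q \<noteq> 0" if "dist Q ?R \<le> \<rho>" for Q
    using that R by fastforce
  define C where "C z = (?H z, momentum z)" for z
  have contC: "continuous_on S C" if "\<And>z. z \<in> S \<Longrightarrow> snd (fst z) \<noteq> 0" for S
    unfolding C_def using hamiltonian_continuous_on[OF I0 that]
    by (intro continuous_intros momentum_continuous_on)
  have "continuous_on (cball ?R \<rho>) (potential ?I)"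
    by (rule continuous_at_imp_continuous_on)
       (use has_derivative_continuous[OF potential_has_derivative] nz in \<open>auto simp: dist_commute\<close>)
  then have "bounded (potential ?I ` cball ?R \<rho>)"
    by (intro compact_imp_bounded compact_continuous_image compact_cball)
  then obtain v where "\<forall>Q\<in>cball ?R \<rho>. \<bar>potential ?I Q\<bar> \<le> v"
    by (auto simp: bounded_iff)
  then have v: "\<bar>potential ?I Q\<bar> \<le> v" if "dist Q ?R \<le> \<rho>" for Q
    using that by (simp add: dist_commute)
  \<comment> \<open>The 1 added to the norm of the momentum here, and to the energy in
    \<open>P\<close>, is the tolerance in \<open>inK\<close>.\<close>
  define m where "m = norm (fst (momentum ?p)) + 1"
  define P where "P = 2 * (?H ?p + 1 + v) + 1"
  define K where "K = (SO3 \<times> cball ?R \<rho>) \<times> (cball (0::vec3) m \<times> cball (0::vec3) P)"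
  have K: "compact K" unfolding K_def by (intro compact_Times compact_SO3 compact_cball)
  have inK: "z \<in> K" if "z \<in> phase_space" "dist (snd (fst z)) ?R \<le> \<rho>" "dist (C z) (C ?p) < 1" for z
  proof -
    have "\<bar>?H z - ?H ?p\<bar> < 1"
      using that(3) dist_fst_le[of "C z" "C ?p"] by (simp add: C_def dist_real_def)
    moreover have "- v \<le> potential ?I (snd (fst z))" using v[OF that(2)] by linarith
    ultimately have "norm (snd (snd z)) \<le> P"
      using hamiltonian_coercive[OF I(1,2), of z "?H ?p + 1" v] by (simp add: P_def)
    moreover have "dist (fst (momentum z)) (fst (momentum ?p)) < 1"
      using that(3) dist_snd_le[of "C z" "C ?p"] dist_fst_le[of "momentum z" "momentum ?p"] by (simp add: C_def)
    then have "norm (fst (snd z)) \<le> m"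
      unfolding norm_momentum[OF that(1)] m_def
      using norm_triangle_ineq2[of "fst (momentum z)" "fst (momentum ?p)"] by (simp add: dist_norm)
    ultimately show ?thesis
      using that(1,2) by (simp add: K_def phase_space_def config_space_def mem_Times_iff dist_commute)
  qed
  have KR: "dist (snd (fst z)) ?R \<le> \<rho>" if "z \<in> K" for z
    using that by (simp add: K_def mem_Times_iff dist_commute)
  have Kps: "z \<in> phase_space" if "z \<in> K" for z
    using that nz[OF KR[OF that]] by (simp add: K_def phase_space_def config_space_def mem_Times_iff)
  have "?R \<noteq> 0" using nz[of ?R] \<rho>(1) by simp
  then have p: "?p \<in> phase_space" and pR: "snd (fst ?p) = ?R"
    by (simp_all add: rel_eq_def phase_space_def config_space_def mat_1_in_SO3)
  show ?thesis
    unfolding Gmu_stable_def Let_def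
  proof (intro allI impI, elim conjE)
    fix U assume "phase_nbhd U ?orbit"
    then obtain V where V: "openin (top_of_set phase_space) V" "?orbit \<subseteq> V" "V \<subseteq> U"
      unfolding phase_nbhd_def by blast
    then obtain N where N: "open N" "V = phase_space \<inter> N"
      unfolding openin_open by blast
    \<comment> \<open>\<open>E\<close> also contains the points of \<open>K\<close> whose position
      lies on the sphere of radius \<rho>; the level set of the equilibrium avoids them too, which
      later prevents crossing.\<close>
    define E where "E = K - (N \<inter> {z. dist (snd (fst z)) ?R < \<rho>})"
    have "open {z::phase. dist (snd (fst z)) ?R < \<rho>}"
      by (intro open_Collect_less continuous_intros)
    then have "compact E" unfolding E_def using N(1) by (intro compact_diff K open_Int)
    moreover have "continuous_on E C"
      by (rule contC) (use nz KR in \<open>auto simp: E_def\<close>)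
    ultimately have "closed (C ` E)"
      by (intro compact_imp_closed compact_continuous_image)
    moreover have "C ?p \<notin> C ` E"
    proof
      assume "C ?p \<in> C ` E"
      then obtain z where "z \<in> E" and Cz: "C z = C ?p" by force
      then have z: "z \<in> K" "z \<notin> N \<inter> {z. dist (snd (fst z)) ?R < \<rho>}"
        by (simp_all add: E_def)
      have H: "?H z = ?H ?p" and J: "momentum z = momentum ?p" using Cz by (simp_all add: C_def)
      note level = rel_eq_level_set[OF I R w(2) min Kps[OF z(1)] KR[OF z(1)] \<rho>(2) H J]
      have "z \<in> N" using level(2) V(2) N(2) by blast
      then show False using z(2) level(1) \<rho>(1) by simp
    qed
    ultimately obtain d where d: "d > 0" "\<And>z. z \<in> E \<Longrightarrow> d \<le> dist (C ?p) (C z)"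
      using separate_point_closed by (metis imageI)
    define \<delta> where "\<delta> = min d 1"
    define W where "W = {z \<in> phase_space. dist (snd (fst z)) ?R < \<rho> \<and> dist (C z) (C ?p) < \<delta>}"
    \<comment> \<open>Self-improvement from \<open>\<le> \<rho>\<close> to \<open>< \<rho>\<close>:
      no phase point with position on the sphere of radius \<rho> has nearby energy and
      momentum.\<close>
    have inN: "z \<in> N" "dist (snd (fst z)) ?R < \<rho>"
      if "z \<in> phase_space" "dist (snd (fst z)) ?R \<le> \<rho>" "dist (C z) (C ?p) < \<delta>" for z
    proof -
      have "z \<in> K" using inK that by (simp add: \<delta>_def)
      moreover have "z \<notin> E" using d(2)[of z] that(3) by (auto simp: \<delta>_def dist_commute)
      ultimately show "z \<in> N" "dist (snd (fst z)) ?R < \<rho>" by (auto simp: E_def)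
    qed
    have WU: "W \<subseteq> U" using inN(1) N(2) V(3) by (auto simp: W_def)
    \<comment> \<open>A curve starting in \<open>W\<close> would have to meet that sphere before
      leaving. The time set is kept general to serve the compact intervals of the existence argument
      as well as the whole line.\<close>
    have trap: "\<gamma> t \<in> W"
      if T: "convex T" "0 \<in> T" "t \<in> T" and 0: "\<gamma> 0 \<in> W"
        and \<gamma>: "\<And>t. t \<in> T \<Longrightarrow> (\<gamma> has_vector_derivative ?X (\<gamma> t)) (at t within T)"
        and ne: "\<And>t. t \<in> T \<Longrightarrow> snd (fst (\<gamma> t)) \<noteq> 0"
      for T t and \<gamma> :: "real \<Rightarrow> phase"
    proof -
      have ps: "\<gamma> 0 \<in> phase_space" using 0 by (simp add: W_def)
      note inv = hamilton_flow_invariants[OF I0 T(1) \<gamma> ne T(2) ps]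
      have C: "dist (C (\<gamma> t)) (C ?p) < \<delta>" if "t \<in> T" for t
        using inv(1,2)[OF _ _ that] 0 by (simp add: C_def W_def)
      have "continuous_on T \<gamma>"
        using \<gamma> by (auto simp: continuous_on_eq_continuous_within dest: has_vector_derivative_continuous)
      then have "continuous_on T (\<lambda>t. dist (snd (fst (\<gamma> t))) ?R)"
        by (intro continuous_intros)
      then have con: "connected ((\<lambda>t. dist (snd (fst (\<gamma> t))) ?R) ` T)"
        using T(1) by (intro connected_continuous_image convex_connected)
      have "dist (snd (fst (\<gamma> t))) ?R < \<rho>"
      proof (rule ccontr)
        assume "\<not> dist (snd (fst (\<gamma> t))) ?R < \<rho>"
        moreover have "dist (snd (fst (\<gamma> 0))) ?R < \<rho>" using 0 by (simp add: W_def)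
        ultimately obtain s where s: "s \<in> T" "dist (snd (fst (\<gamma> s))) ?R = \<rho>"
          using connectedD_interval[OF con imageI[OF T(2)] imageI[OF T(3)], of \<rho>] by force
        then show False using inN(2)[OF inv(3)[OF _ _ s(1)] _ C[OF s(1)]] by simp
      qed
      then show ?thesis using inv(3)[OF _ _ T(3)] C[OF T(3)] by (simp add: W_def)
    qed
    have "phase_nbhd W {?p}"
    proof -
      have "continuous_on phase_space C"
        by (rule contC) (auto simp: phase_space_def config_space_def)
      then have "continuous_on phase_space (\<lambda>z. dist (C z) (C ?p))"
        by (intro continuous_intros)
      then have "openin (top_of_set phase_space) (phase_space \<inter> (\<lambda>z. dist (C z) (C ?p)) -` {..<\<delta>})"
        by (rule continuous_openin_preimage_gen) simp
      moreover have "openin (top_of_set phase_space) (phase_space \<inter> (\<lambda>z. dist (snd (fst z)) ?R) -` {..<\<rho>})"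
        by (intro continuous_openin_preimage_gen continuous_intros open_lessThan)
      moreover have "W = (phase_space \<inter> (\<lambda>z. dist (C z) (C ?p)) -` {..<\<delta>}) \<inter>
          (phase_space \<inter> (\<lambda>z. dist (snd (fst z)) ?R) -` {..<\<rho>})"
        by (auto simp: W_def)
      ultimately have "openin (top_of_set phase_space) W" by (metis openin_Int)
      moreover have "?p \<in> W" using p pR \<rho>(1) d(1) by (simp add: W_def \<delta>_def)
      ultimately show ?thesis by (auto simp: phase_nbhd_def W_def)
    qed
    moreover have "\<exists>\<gamma>. evolution ?I \<gamma> \<and> \<gamma> 0 = z" if z: "z \<in> W" for z
    proof -
      \<comment> \<open>A convex enlargement of \<open>K\<close>: a matrix ball of radius 4 replaces
        \<open>SO3\<close>, which lies in the ball of radius 3, and the margins put \<open>W\<close>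
        in the interior. The position ball needs none, since positions in \<open>W\<close> have
        distance strictly below \<rho>.\<close>
      define D where "D = (cball (0::mat3) 4 \<times> cball ?R \<rho>) \<times> (cball (0::vec3) (m + 1) \<times> cball (0::vec3) (P + 1))"
      have D: "convex D" "compact D" "bounded D"
        unfolding D_def by (intro convex_Times compact_Times bounded_Times convex_cball compact_cball bounded_cball)+
      have DR: "dist (snd (fst z)) ?R \<le> \<rho>" if "z \<in> D" for z
        using that by (auto simp: D_def dist_commute)
      obtain L where L: "L-lipschitz_on D ?X"
        using hamilton_field_lipschitz[OF D(3), of "R / 2"] far[OF DR] R by auto
      have WD: "W \<subseteq> interior D"
      proof
        fix z assume z: "z \<in> W"
        then have "z \<in> K" using inK by (simp add: W_def \<delta>_def)
        then have "z \<in> (ball 0 4 \<times> ball ?R \<rho>) \<times> (ball 0 (m + 1) \<times> ball 0 (P + 1))"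
          using z SO3_bounded[of "fst (fst z)"] by (auto simp: K_def W_def mem_Times_iff dist_commute)
        moreover have "(ball 0 4 \<times> ball ?R \<rho>) \<times> (ball 0 (m + 1) \<times> ball 0 (P + 1)) \<subseteq> interior D"
          by (intro interior_maximal open_Times open_ball) (auto simp: D_def)
        ultimately show "z \<in> interior D" by blast
      qed
      have "\<exists>\<gamma>. \<gamma> 0 = z \<and> (\<forall>t. \<gamma> t \<in> D) \<and> (\<forall>t. (\<gamma> has_vector_derivative ?X (\<gamma> t)) (at t))"
      proof (rule global_solution_trapped[OF D(1,2) L, of z])
        show "z \<in> D" using z WD interior_subset by blast
        fix a b :: real and \<gamma> :: "real \<Rightarrow> phase" and t
        assume *: "a \<le> 0" "0 \<le> b" "\<gamma> 0 = z" "\<And>s. s \<in> {a..b} \<Longrightarrow> \<gamma> s \<in> D"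
          "\<And>s. s \<in> {a..b} \<Longrightarrow> (\<gamma> has_vector_derivative ?X (\<gamma> s)) (at s within {a..b})" "t \<in> {a..b}"
        have "\<gamma> t \<in> W"
          by (rule trap[of "{a..b}"]) (use * z nz[OF DR] in auto)
        then show "\<gamma> t \<in> interior D" using WD by blast
      qed blast
      then obtain \<gamma> where \<gamma>: "\<gamma> 0 = z" "\<And>t. \<gamma> t \<in> D"
        "\<And>t. (\<gamma> has_vector_derivative ?X (\<gamma> t)) (at t)" by blast
      have ne: "snd (fst (\<gamma> t)) \<noteq> 0" for t by (rule nz[OF DR[OF \<gamma>(2)]])
      have "\<gamma> t \<in> W" for t
        by (rule trap[of UNIV]) (use \<gamma>(1,3) z ne in auto)
      then have "\<gamma> t \<in> phase_space" for t by (simp add: W_def)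
      then have "evolution ?I \<gamma>"
        using \<gamma>(3) unfolding evolution_def ham_vf_hamiltonian[OF I0 ne] by blast
      then show ?thesis using \<gamma>(1) by blast
    qed
    moreover have "\<gamma> t \<in> U" if \<gamma>: "evolution ?I \<gamma>" "\<gamma> 0 \<in> W" for \<gamma> t
    proof -
      have ne: "snd (fst (\<gamma> t)) \<noteq> 0" for t
        using \<gamma>(1) by (auto simp: evolution_def phase_space_def config_space_def mem_Times_iff)
      have d\<gamma>: "(\<gamma> has_vector_derivative ?X (\<gamma> t)) (at t)" for t
        using \<gamma>(1) unfolding evolution_def ham_vf_hamiltonian[OF I0 ne] by blast
      have "\<gamma> t \<in> W"
        by (rule trap[of UNIV]) (use d\<gamma> \<gamma>(2) ne in auto)
      then show ?thesis using WU by blast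
    qed
    ultimately show "\<exists>W. phase_nbhd W {?p} \<and> (\<forall>z\<in>W. (\<exists>\<gamma>. evolution ?I \<gamma> \<and> \<gamma> 0 = z) \<and>
        (\<forall>\<gamma>. evolution ?I \<gamma> \<and> \<gamma> 0 = z \<longrightarrow> (\<forall>t. \<gamma> t \<in> U)))"
      by blast
  qed
qed

theorem proposition4p14:
  fixes I\<^sub>1 I\<^sub>2 R \<xi>\<^sub>2 \<eta> :: real and \<xi> \<R> :: "real^3" and p :: phase
  assumes "0 < I\<^sub>1" "I\<^sub>1 < 1/2" "0 < I\<^sub>2" "I\<^sub>2 < 1/2" "I\<^sub>1 + 2 * I\<^sub>2 = 1"
    and "\<xi> = vector [0, \<xi>\<^sub>2, 0]" "\<R> = vector [R, 0, 0]" "\<eta> = 0" "R > 0"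
    and "(norm \<xi>)\<^sup>2 = (2 * R\<^sup>2 + 3 - 9 * I\<^sub>1) / (2 * R ^ 5)"
    and "(2 * R\<^sup>2 + 3 - 9 * I\<^sub>1) / (2 * R ^ 5) > 0"
    and "p = phase_point (inertia I\<^sub>1 I\<^sub>2) (mat 1, \<R>) (\<xi>, \<eta>)"
    and "relative_equilibrium (inertia I\<^sub>1 I\<^sub>2) p (\<xi>, \<eta>)"
    and "R ^ 4 > 3 * R\<^sup>2 * (2 * I\<^sub>2 - I\<^sub>1) + 15 * I\<^sub>2 * (I\<^sub>2 - I\<^sub>1)"
  shows "(I\<^sub>1 < I\<^sub>2 \<longrightarrow> Gmu_stable (inertia I\<^sub>1 I\<^sub>2) p) \<and>
         (I\<^sub>1 > I\<^sub>2 \<and> 4 * I\<^sub>2 - 3 * I\<^sub>1 > 6 * I\<^sub>2 * (I\<^sub>1 - I\<^sub>2) / R\<^sup>2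
            \<longrightarrow> unstable (inertia I\<^sub>1 I\<^sub>2) p (\<xi>, \<eta>))"
proof -
  have p: "p = rel_eq I\<^sub>2 R \<xi>\<^sub>2"
    using assms(6-8,12) by (simp add: phase_point_rel_eq)
  have w: "\<xi>\<^sub>2\<^sup>2 = (2 * R\<^sup>2 + 3 - 9 * I\<^sub>1) / (2 * R ^ 5)"
    using assms(6,10) by (simp add: norm_vector_2)
  then have w0: "\<xi>\<^sub>2 \<noteq> 0" using assms(11) by auto
  show ?thesis
    using rel_eq_stable[OF assms(1,3,5) _ assms(9) w w0 assms(14)]
      rel_eq_unstable[OF assms(1,3,5,9) w w0 assms(14)] assms(6,8)
    by (simp add: p)
qed

end
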